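(* Let $d\ge2$, $1<p<\infty$ and $0<s<1/2$. (i) There are real-valued Schwartz functions $f_N,g_N$ ($N\in\mathbb N$) on $\mathbb R^d$ such that $$\sup_N\|f_N\|_{\dot B^s_{p,1}}+\sup_N\|g_N\|_{\dot B^{s-1}_{p,1}}<\infty,\qquad\text{but}\qquad\|f_Ng_N\|_{\dot B^{s-1}_{p,1}}\to\infty.$$ (ii) There are real-valued Schwartz vector fields $a_N,Y_N$ ($N\in\mathbb N$) on $\mathbb R^d$, with $a_N$ not divergence free, such that $$\sup_N\|a_N\|_{\dot B^{s-1}_{p,1}}+\sup_N\|Y_N\|_{\dot B^{s+1}_{p,1}}<\infty,\qquad\text{while}\qquad\|(a_N\cdot\nabla)Y_N\|_{\dot B^{s-1}_{p,1}}\to\infty.$$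
   Context: $\dot B^\gamma_{p,1}(\mathbb R^d)$ is the homogeneous Besov space with norm $\|f\|_{\dot B^\gamma_{p,1}}=\sum_{j\in\mathbb Z}2^{j\gamma}\|\dot\Delta_jf\|_{L^p}$, where $\dot\Delta_j$ are homogeneous Littlewood--Paley projectors; vector norms are componentwise. Here $p$ and $s$ are independent parameters. *)

theory Defs
  imports "HOL-Analysis.Analysis"
begin

definition partial_deriv :: "'n::finite \<Rightarrow> (real^'n \<Rightarrow> 'b::real_normed_vector) \<Rightarrow> real^'n \<Rightarrow> 'b"
  where "partial_deriv k f x = frechet_derivative f (at x) (axis k 1)"

primrec iter_partial :: "'n::finite list \<Rightarrow> (real^'n \<Rightarrow> 'b::real_normed_vector) \<Rightarrow> real^'n \<Rightarrow> 'b"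
  where
    "iter_partial [] f = f"
  | "iter_partial (k # ks) f = partial_deriv k (iter_partial ks f)"

definition smooth :: "(real^'n::finite \<Rightarrow> 'b::real_normed_vector) \<Rightarrow> bool"
  where "smooth f \<longleftrightarrow> (\<forall>ks x. iter_partial ks f differentiable (at x))"

definition schwartz :: "(real^'n::finite \<Rightarrow> 'b::real_normed_vector) \<Rightarrow> bool"
  where "schwartz f \<longleftrightarrow> smooth f \<and>
    (\<forall>ks (m::nat). bounded (range (\<lambda>x. norm x ^ m *\<^sub>R iter_partial ks f x)))"

definition fourier :: "(real^'n::finite \<Rightarrow> complex) \<Rightarrow> real^'n \<Rightarrow> complex"
  where "fourier f \<xi> = (LINT x|lborel. cis (- (x \<bullet> \<xi>)) * f x)"

definition inv_fourier :: "(real^'n::finite \<Rightarrow> complex) \<Rightarrow> real^'n \<Rightarrow> complex"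
  where "inv_fourier g x =
    complex_of_real (1 / (2 * pi) ^ CARD('n)) * (LINT \<xi>|lborel. cis (x \<bullet> \<xi>) * g \<xi>)"

(* The profile of a homogeneous Littlewood-Paley decomposition. The annulus is left
   arbitrary, so that all the usual normalisations (e.g. 3/4 \<le> |\<xi>| \<le> 8/3) are covered. *)
definition LP_cutoff :: "(real^'n::finite \<Rightarrow> real) \<Rightarrow> bool"
  where "LP_cutoff \<phi> \<longleftrightarrow>
    smooth \<phi> \<and>
    (\<forall>\<xi> \<eta>. norm \<xi> = norm \<eta> \<longrightarrow> \<phi> \<xi> = \<phi> \<eta>) \<and>
    (\<forall>\<xi>. 0 \<le> \<phi> \<xi> \<and> \<phi> \<xi> \<le> 1) \<and>
    (\<exists>r R. 0 < r \<and> r < R \<and> (\<forall>\<xi>. \<phi> \<xi> \<noteq> 0 \<longrightarrow> r \<le> norm \<xi> \<and> norm \<xi> \<le> R)) \<and>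
    (\<forall>\<xi>. \<xi> \<noteq> 0 \<longrightarrow> ((\<lambda>j::int. \<phi> (2 powi (- j) *\<^sub>R \<xi>)) has_sum 1) UNIV)"

(* The Fourier multiplier with symbol \<phi>(2^(-j) \<xi>). It is only used on Schwartz functions,
   for which all the integrals involved converge absolutely. *)
definition LP_proj :: "(real^'n::finite \<Rightarrow> real) \<Rightarrow> int \<Rightarrow> (real^'n \<Rightarrow> complex) \<Rightarrow> real^'n \<Rightarrow> complex"
  where "LP_proj \<phi> j f =
    inv_fourier (\<lambda>\<xi>. complex_of_real (\<phi> (2 powi (- j) *\<^sub>R \<xi>)) * fourier f \<xi>)"

(* [0,\<infinity>]-valued; the case distinction is needed because powr is not available on ennreal. *)
definition Lp_norm :: "real \<Rightarrow> (real^'n::finite \<Rightarrow> complex) \<Rightarrow> ennreal"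
  where "Lp_norm p f =
    (let I = \<integral>\<^sup>+ x. ennreal (norm (f x) powr p) \<partial>lborel
     in if I = \<infinity> then \<infinity> else ennreal (enn2real I powr (1 / p)))"

(* The norm of the homogeneous Besov space with indices \<gamma>, p and 1, with value \<infinity> if the
   series diverges; infsum on ennreal is the supremum of the finite partial sums. *)
definition besov_norm :: "(real^'n::finite \<Rightarrow> real) \<Rightarrow> real \<Rightarrow> real \<Rightarrow> (real^'n \<Rightarrow> real) \<Rightarrow> ennreal"
  where "besov_norm \<phi> \<gamma> p f =
    (\<Sum>\<^sub>\<infinity>j::int. ennreal (2 powr (of_int j * \<gamma>)) *
       Lp_norm p (LP_proj \<phi> j (\<lambda>x. complex_of_real (f x))))"

definition besov_norm_vec ::
  "(real^'n::finite \<Rightarrow> real) \<Rightarrow> real \<Rightarrow> real \<Rightarrow> (real^'n \<Rightarrow> real^'n) \<Rightarrow> ennreal"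
  where "besov_norm_vec \<phi> \<gamma> p v = (\<Sum>i\<in>UNIV. besov_norm \<phi> \<gamma> p (\<lambda>x. v x $ i))"

definition divergence :: "(real^'n::finite \<Rightarrow> real^'n) \<Rightarrow> real^'n \<Rightarrow> real"
  where "divergence a x = (\<Sum>k\<in>UNIV. partial_deriv k (\<lambda>y. a y $ k) x)"

definition divergence_free :: "(real^'n::finite \<Rightarrow> real^'n) \<Rightarrow> bool"
  where "divergence_free a \<longleftrightarrow> (\<forall>x. divergence a x = 0)"

(* (a \<cdot> \<nabla>) Y *)
definition advect :: "(real^'n::finite \<Rightarrow> real^'n) \<Rightarrow> (real^'n \<Rightarrow> real^'n) \<Rightarrow> real^'n \<Rightarrow> real^'n"
  where "advect a Y x = (\<Sum>k\<in>UNIV. a x $ k *\<^sub>R partial_deriv k Y x)"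

end

theory Submission
  imports Defs "HOL-Probability.Characteristic_Functions"
begin

text \<open>
The product fails to be bounded because two high frequencies can interact to produce a low one.
Let \<open>\<Psi>\<close> be the inverse Fourier transform of the cutoff \<open>\<phi>\<close>, fix a coordinate direction \<open>k\<close>, and
put \<open>w(x) = Re (\<Psi>(x) exp (i (\<nu> x_k - \<theta>)))\<close> with \<open>\<nu> = 2^N\<close>.  The spectrum of \<open>w\<close> lies within a fixed distance
of \<open>\<plusminus>\<nu> e_k\<close>.  Hence only boundedly many blocks, those with \<open>2^j\<close> comparable to \<open>\<nu>\<close>, see \<open>w\<close>, and
each of them is bounded in \<open>L^p\<close> by a constant since \<open>|w| \<le> |\<Psi>|\<close>.  So \<open>\<nu>^(-\<gamma>) w\<close> is bounded in the
space of regularity \<open>\<gamma>\<close>, for every real \<open>\<gamma>\<close> (\<open>besov_norm_wave_packet_le\<close>).  In contrast, the product of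
\<open>f = \<nu>^(-s) w\<close> and \<open>g = \<nu>^(1-s) w\<close> is \<open>\<nu>^(1-2s) w^2\<close>.  The function \<open>w^2\<close> is nonnegative and dominated by
\<open>|\<Psi>|^2\<close>, and for a suitable phase \<open>\<theta>\<close> it keeps half of the mass of \<open>|\<Psi>|^2\<close> (\<open>wave_packet_phase\<close>).
Such a function has a low-frequency block of norm bounded below, and the same block serves for all
\<open>\<nu>\<close> (\<open>Lp_norm_LP_proj_ge\<close>).  Since \<open>1 - 2 s > 0\<close>, the norm of the product is unbounded.

For the transport term, take \<open>a = g e_k\<close>, and let \<open>Y\<close> be \<open>\<nu>^(-s-1) w' e_k\<close>, where \<open>w'\<close> is \<open>w\<close> with
the phase advanced by a quarter period.  The derivative of \<open>w'\<close> in direction \<open>k\<close> is \<open>\<nu> w\<close> plus a packet of size one, so the \<open>k\<close>-th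
component of \<open>(a \<cdot> \<nabla>) Y\<close> is \<open>\<nu>^(1-2s)\<close> times an \<open>L^1\<close> perturbation of \<open>w^2\<close> of size \<open>1 / \<nu>\<close>, and the lower bound tolerates
small perturbations.  The divergence of \<open>a\<close> is the derivative of \<open>g\<close> in direction \<open>k\<close>; it cannot vanish identically, because
\<open>g\<close> would then be constant along lines while decaying.

It matters that the spectrum of \<open>w\<close> avoids a neighbourhood of the origin entirely: the weights \<open>2^(j (s - 1))\<close> are
unbounded as \<open>j\<close> tends to \<open>-\<infinity>\<close>, and for \<open>p\<close> near \<open>1\<close> even a tiny nonzero value of the Fourier transform at the
origin would make the norm infinite.  This is why \<open>\<Psi>\<close> is built from a compactly supported symbol, and why Fourier inversion is
proved for such symbols (\<open>fourier_inv_fourier\<close>).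
\<close>

section \<open>Smooth functions and Schwartz functions\<close>

lemma partial_deriv_eqI:
  assumes "(f has_derivative f') (at x)"
  shows "partial_deriv k f x = f' (axis k 1)"
  using frechet_derivative_at[OF assms] by (simp add: partial_deriv_def)

lemma has_derivative_frechet:
  "f differentiable (at x) \<Longrightarrow> (f has_derivative frechet_derivative f (at x)) (at x)"
  using frechet_derivative_works by blast

lemma iter_partial_snoc: "iter_partial (ks @ [k]) f = iter_partial ks (partial_deriv k f)"
  by (induction ks) auto

lemma smooth_partial_deriv: "smooth f \<Longrightarrow> smooth (partial_deriv k f)"
  unfolding smooth_def by (metis iter_partial_snoc)

lemma smooth_differentiable: "smooth f \<Longrightarrow> f differentiable (at x)"
  unfolding smooth_def by (metis iter_partial.simps(1))

lemma smooth_continuous: "smooth f \<Longrightarrow> continuous_on UNIV f"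
  by (simp add: continuous_at_imp_continuous_on differentiable_imp_continuous_within smooth_differentiable)

text \<open>Iterated partial derivatives apply the newest derivative last, so a class of differentiable functions
that is closed under \<open>partial_deriv\<close> contains all iterated partial derivatives of its members.  Closure under
linear maps, translations and products is obtained by exhibiting such a class, which avoids any Leibniz formula
for iterated derivatives.\<close>

lemma smooth_coinduct:
  assumes "P f"
    and diff: "\<And>f x. P f \<Longrightarrow> f differentiable (at x)"
    and step: "\<And>f k. P f \<Longrightarrow> P (partial_deriv k f)"
  shows "smooth f"
proof -
  have "P (iter_partial ks f)" for ks
    by (induction ks) (auto intro: assms)
  then show ?thesis by (auto simp: smooth_def intro: diff)
qed

lemma schwartz_coinduct:
  assumes "P f"
    and diff: "\<And>f x. P f \<Longrightarrow> f differentiable (at x)"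
    and step: "\<And>f k. P f \<Longrightarrow> P (partial_deriv k f)"
    and bound: "\<And>f m. P f \<Longrightarrow> bounded (range (\<lambda>x. norm x ^ m *\<^sub>R f x))"
  shows "schwartz f"
proof -
  have "P (iter_partial ks f)" for ks
    by (induction ks) (auto intro: assms)
  then show ?thesis
    using smooth_coinduct[of P f, OF assms(1-3)] by (auto simp: schwartz_def intro: bound)
qed

lemma partial_deriv_bounded_linear:
  assumes "bounded_linear L" "f differentiable (at x)"
  shows "partial_deriv k (\<lambda>x. L (f x)) x = L (partial_deriv k f x)"
  using partial_deriv_eqI[OF bounded_linear.has_derivative[OF assms(1) has_derivative_frechet[OF assms(2)]]]
  by (simp add: partial_deriv_def)

lemma differentiable_bounded_linear:
  assumes "bounded_linear L" "f differentiable (at x)"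
  shows "(\<lambda>x. L (f x)) differentiable (at x)"
  using bounded_linear.has_derivative[OF assms(1) has_derivative_frechet[OF assms(2)]]
  unfolding differentiable_def by blast

lemma smooth_bounded_linear:
  assumes L: "bounded_linear L" and "smooth f"
  shows "smooth (\<lambda>x. L (f x))"
proof (rule smooth_coinduct[where P = "\<lambda>g. \<exists>f. smooth f \<and> g = (\<lambda>x. L (f x))"])
  fix g x assume "\<exists>f. smooth f \<and> g = (\<lambda>x. L (f x))"
  then show "g differentiable (at x)"
    using differentiable_bounded_linear[OF L smooth_differentiable] by blast
next
  fix g k assume "\<exists>f. smooth f \<and> g = (\<lambda>x. L (f x))"
  then show "\<exists>f. smooth f \<and> partial_deriv k g = (\<lambda>x. L (f x))"
    using smooth_partial_deriv partial_deriv_bounded_linear[OF L smooth_differentiable] by blast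
qed (use assms in blast)

lemma schwartz_partial_deriv: "schwartz f \<Longrightarrow> schwartz (partial_deriv k f)"
  unfolding schwartz_def using smooth_partial_deriv by (metis iter_partial_snoc)

lemma schwartz_bounded:
  assumes "schwartz f"
  shows "bounded (range (\<lambda>x. norm x ^ m *\<^sub>R f x))"
  using assms iter_partial.simps(1)[of f] unfolding schwartz_def by metis

lemma schwartz_bounded_linear:
  assumes L: "bounded_linear L" and "schwartz f"
  shows "schwartz (\<lambda>x. L (f x))"
proof (rule schwartz_coinduct[where P = "\<lambda>g. \<exists>f. schwartz f \<and> g = (\<lambda>x. L (f x))"])
  fix g x assume "\<exists>f. schwartz f \<and> g = (\<lambda>x. L (f x))"
  then show "g differentiable (at x)"
    using differentiable_bounded_linear[OF L smooth_differentiable] by (auto simp: schwartz_def)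
next
  fix g k assume "\<exists>f. schwartz f \<and> g = (\<lambda>x. L (f x))"
  then show "\<exists>f. schwartz f \<and> partial_deriv k g = (\<lambda>x. L (f x))"
    using schwartz_partial_deriv partial_deriv_bounded_linear[OF L smooth_differentiable]
    unfolding schwartz_def by blast
next
  fix g m assume "\<exists>f. schwartz f \<and> g = (\<lambda>x. L (f x))"
  then obtain f where f: "schwartz f" "g = (\<lambda>x. L (f x))" by blast
  have "range (\<lambda>x. norm x ^ m *\<^sub>R g x) = L ` range (\<lambda>x. norm x ^ m *\<^sub>R f x)"
    by (simp add: f(2) image_image linear_cmul[OF bounded_linear.linear[OF L]])
  then show "bounded (range (\<lambda>x. norm x ^ m *\<^sub>R g x))"
    by (metis bounded_linear_image[OF schwartz_bounded[OF f(1)] L])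
qed (use assms in blast)

lemma smooth_translate:
  fixes f :: "real^'n::finite \<Rightarrow> 'b::real_normed_vector"
  assumes "smooth f"
  shows "smooth (\<lambda>x. f (x - a))"
proof -
  have D: "((\<lambda>x. f (x - a)) has_derivative frechet_derivative f (at (x - a))) (at x)"
    if f: "smooth f" for f :: "real^'n \<Rightarrow> 'b" and x
  proof -
    have "((\<lambda>x. x - a) has_derivative (\<lambda>h. h)) (at x)"
      using has_derivative_diff[OF has_derivative_ident has_derivative_const] by simp
    from diff_chain_at[OF this has_derivative_frechet[OF smooth_differentiable[OF f]]]
    show ?thesis by (simp add: o_def)
  qed
  show ?thesis
  proof (rule smooth_coinduct[where P = "\<lambda>g. \<exists>f. smooth f \<and> g = (\<lambda>x. f (x - a))"])
    fix g :: "real^'n \<Rightarrow> 'b" and x assume "\<exists>f. smooth f \<and> g = (\<lambda>x. f (x - a))"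
    then obtain f where f: "smooth f" "g = (\<lambda>x. f (x - a))" by blast
    from D[OF f(1), of x] show "g differentiable (at x)" unfolding f(2) by (rule differentiableI)
  next
    fix g :: "real^'n \<Rightarrow> 'b" and k assume "\<exists>f. smooth f \<and> g = (\<lambda>x. f (x - a))"
    then obtain f where f: "smooth f" "g = (\<lambda>x. f (x - a))" by blast
    have "partial_deriv k g = (\<lambda>x. partial_deriv k f (x - a))"
      using partial_deriv_eqI[OF D[OF f(1)]] by (auto simp: f(2) partial_deriv_def)
    then show "\<exists>f. smooth f \<and> partial_deriv k g = (\<lambda>x. f (x - a))"
      using smooth_partial_deriv[OF f(1)] by blast
  qed (use assms in blast)
qed

text \<open>The closure of the products of smooth functions under sums: the Leibniz rule keeps a
derivative of a product inside this class, though not inside the class of products.\<close>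

inductive product_span :: "(real^'n::finite \<Rightarrow> complex) \<Rightarrow> bool" where
  prod: "smooth u \<Longrightarrow> smooth v \<Longrightarrow> product_span (\<lambda>x. u x * v x)"
| add: "product_span f \<Longrightarrow> product_span g \<Longrightarrow> product_span (\<lambda>x. f x + g x)"

lemma product_span_differentiable: "product_span f \<Longrightarrow> f differentiable (at x)"
  by (induction rule: product_span.induct) (auto intro!: differentiable_mult intro: smooth_differentiable)

lemma smooth_mult:
  fixes u v :: "real^'n::finite \<Rightarrow> complex"
  assumes "smooth u" "smooth v"
  shows "smooth (\<lambda>x. u x * v x)"
proof (rule smooth_coinduct[where P = product_span])
  fix f :: "real^'n \<Rightarrow> complex" and k assume "product_span f"
  then show "product_span (partial_deriv k f)"
  proof (induction rule: product_span.induct)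
    case (prod u v)
    have "partial_deriv k (\<lambda>x. u x * v x) = (\<lambda>x. u x * partial_deriv k v x + partial_deriv k u x * v x)"
    proof
      fix x
      show "partial_deriv k (\<lambda>x. u x * v x) x = u x * partial_deriv k v x + partial_deriv k u x * v x"
        using partial_deriv_eqI[OF has_derivative_mult[OF has_derivative_frechet[OF smooth_differentiable[OF prod(1)]]
             has_derivative_frechet[OF smooth_differentiable[OF prod(2)]]]]
        by (simp add: partial_deriv_def)
    qed
    then show ?case using prod smooth_partial_deriv by (auto intro!: product_span.intros)
  next
    case (add f g)
    have "partial_deriv k (\<lambda>x. f x + g x) = (\<lambda>x. partial_deriv k f x + partial_deriv k g x)"
    proof
      fix x
      show "partial_deriv k (\<lambda>x. f x + g x) x = partial_deriv k f x + partial_deriv k g x"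
        using partial_deriv_eqI[OF has_derivative_add[OF has_derivative_frechet[OF product_span_differentiable[OF add(1)]]
             has_derivative_frechet[OF product_span_differentiable[OF add(2)]]]]
        by (simp add: partial_deriv_def)
    qed
    then show ?case using add by (auto intro!: product_span.intros)
  qed
qed (use assms product_span.prod product_span_differentiable in blast)+

lemma partial_deriv_const [simp]: "partial_deriv k (\<lambda>x. c) = (\<lambda>x. 0)"
  by (rule ext) (rule partial_deriv_eqI[OF has_derivative_const])

lemma smooth_const: "smooth (\<lambda>x. c)"
proof (rule smooth_coinduct[where P = "\<lambda>g. \<exists>c. g = (\<lambda>x. c)"])
  fix g :: "real^'a \<Rightarrow> 'b" and k assume "\<exists>c. g = (\<lambda>x. c)"
  then show "\<exists>c. partial_deriv k g = (\<lambda>x. c)"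
    by auto
qed auto

lemma smooth_linear:
  assumes L: "bounded_linear L"
  shows "smooth L"
proof (rule smooth_coinduct[where P = "\<lambda>g. g = L \<or> (\<exists>c. g = (\<lambda>x. c))"])
  fix g k assume "g = L \<or> (\<exists>c. g = (\<lambda>x. c))"
  moreover have "partial_deriv k L = (\<lambda>x. L (axis k 1))" for k
    by (rule ext) (rule partial_deriv_eqI[OF bounded_linear_imp_has_derivative[OF L]])
  ultimately show "partial_deriv k g = L \<or> (\<exists>c. partial_deriv k g = (\<lambda>x. c))"
    by auto
qed (use bounded_linear_imp_differentiable[OF L] in auto)

section \<open>Test functions\<close>

text \<open>Test functions serve as symbols on the frequency side; they are complex-valued because modulating a packet and
differentiating it multiply the symbol by complex factors.\<close>

definition test_function :: "(real^'n::finite \<Rightarrow> complex) \<Rightarrow> bool" where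
  "test_function h \<longleftrightarrow> smooth h \<and> (\<exists>R. \<forall>\<xi>. norm \<xi> > R \<longrightarrow> h \<xi> = 0)"

lemma test_function_mult:
  assumes "smooth u" "test_function h"
  shows "test_function (\<lambda>\<xi>. u \<xi> * h \<xi>)"
  using assms smooth_mult[of u h] unfolding test_function_def by force

lemma test_function_translate:
  assumes "test_function h"
  shows "test_function (\<lambda>\<xi>. h (\<xi> - a))"
proof -
  obtain R where "\<And>\<xi>. norm \<xi> > R \<Longrightarrow> h \<xi> = 0" using assms test_function_def by blast
  then have "h (\<xi> - a) = 0" if "norm \<xi> > R + norm a" for \<xi>
    using that norm_triangle_ineq2[of \<xi> a] by force
  then show ?thesis using assms smooth_translate unfolding test_function_def by blast
qed

lemma partial_deriv_outside_support:
  assumes "\<And>\<xi>. norm \<xi> > R \<Longrightarrow> h \<xi> = 0" "norm \<xi> > R"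
  shows "partial_deriv k h \<xi> = 0"
proof -
  have "open {\<xi>::real^'a. norm \<xi> > R}" by (intro open_Collect_less continuous_intros)
  then have "(h has_derivative (\<lambda>v. 0)) (at \<xi>)"
    by (rule has_derivative_transform_within_open[OF has_derivative_const[of 0]]) (use assms in auto)
  from partial_deriv_eqI[OF this] show ?thesis by simp
qed

lemma test_function_partial_deriv:
  assumes "test_function h"
  shows "test_function (partial_deriv k h)"
proof -
  obtain R where R: "\<And>\<xi>. norm \<xi> > R \<Longrightarrow> h \<xi> = 0" using assms test_function_def by blast
  then have "norm \<xi> > R \<longrightarrow> partial_deriv k h \<xi> = 0" for \<xi>
    by (blast intro: partial_deriv_outside_support)
  then show ?thesis
    using assms smooth_partial_deriv unfolding test_function_def by blast
qed

lemma integrable_continuous_compact_support: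
  fixes h :: "'a::euclidean_space \<Rightarrow> 'b::{banach,second_countable_topology}"
  assumes "continuous_on UNIV h" "\<And>\<xi>. norm \<xi> > R \<Longrightarrow> h \<xi> = 0"
  shows "integrable lborel h"
proof -
  have "integrable lborel (\<lambda>x. indicator (cball 0 R) x *\<^sub>R h x)"
    by (rule borel_integrable_compact) (use assms(1) continuous_on_subset in auto)
  also have "(\<lambda>x. indicator (cball 0 R) x *\<^sub>R h x) = h"
    using assms(2) by (force simp: indicator_def)
  finally show ?thesis .
qed

lemma test_function_continuous: "test_function h \<Longrightarrow> continuous_on UNIV h"
  by (simp add: test_function_def smooth_continuous)

lemma test_function_integrable: "test_function h \<Longrightarrow> integrable lborel h"
  using integrable_continuous_compact_support test_function_continuous test_function_def by metis

lemma test_function_bounded: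
  assumes "test_function h"
  obtains B where "\<And>\<xi>. norm (h \<xi>) \<le> B"
proof -
  obtain R where R: "\<And>\<xi>. norm \<xi> > R \<Longrightarrow> h \<xi> = 0" using assms test_function_def by blast
  have "compact (h ` cball 0 R)"
    by (meson assms compact_cball compact_continuous_image continuous_on_subset subset_UNIV test_function_continuous)
  then have "bounded (h ` cball 0 R)" by (rule compact_imp_bounded)
  then obtain B where B: "\<forall>y\<in>h ` cball 0 R. norm y \<le> B" unfolding bounded_iff by blast
  have "norm (h \<xi>) \<le> max B 0" for \<xi>
  proof (cases "norm \<xi> \<le> R")
    case True
    then have "norm (h \<xi>) \<le> B" using B by simp
    then show ?thesis by simp
  qed (use R[of \<xi>] in simp)
  then show ?thesis by (rule that)
qed

section \<open>Affine changes of variables\<close>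

text \<open>Lebesgue measure under \<open>x \<mapsto> t + c x\<close>.  The dilations produce the scaling of the kernels and of the
Gaussian, the translations produce modulations, and \<open>c = -1\<close> serves convolutions.\<close>

lemma nn_integral_lborel_affine:
  fixes f :: "'a::euclidean_space \<Rightarrow> ennreal"
  assumes [measurable]: "f \<in> borel_measurable borel" and c: "c \<noteq> 0"
  shows "(\<integral>\<^sup>+x. f x \<partial>lborel) = ennreal (\<bar>c\<bar> ^ DIM('a)) * (\<integral>\<^sup>+x. f (t + c *\<^sub>R x) \<partial>lborel)"
  by (subst lborel_affine[OF c, of t])
     (simp add: nn_integral_density nn_integral_distr nn_integral_cmult ennreal_power)

lemma integrable_lborel_affine:
  fixes f :: "'a::euclidean_space \<Rightarrow> 'b::{banach,second_countable_topology}"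
  assumes f: "integrable lborel f" and c: "c \<noteq> 0"
  shows "integrable lborel (\<lambda>x. f (t + c *\<^sub>R x))"
proof -
  have [measurable]: "f \<in> borel_measurable borel" using f by auto
  have "ennreal (\<bar>c\<bar> ^ DIM('a)) * (\<integral>\<^sup>+x. norm (f (t + c *\<^sub>R x)) \<partial>lborel) < \<infinity>"
    using f nn_integral_lborel_affine[of "\<lambda>x. ennreal (norm (f x))" c t] c
    by (simp add: integrable_iff_bounded)
  moreover have "ennreal (\<bar>c\<bar> ^ DIM('a)) \<noteq> 0" using c by (simp add: ennreal_eq_0_iff not_le)
  ultimately have "(\<integral>\<^sup>+x. norm (f (t + c *\<^sub>R x)) \<partial>lborel) < \<infinity>"
    by (auto simp: ennreal_mult_less_top)
  then show ?thesis by (intro integrableI_bounded) auto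
qed

lemma integral_lborel_affine:
  fixes f :: "'a::euclidean_space \<Rightarrow> 'b::{banach,second_countable_topology}"
  assumes c: "c \<noteq> 0"
  shows "(\<integral>x. f x \<partial>lborel) = \<bar>c\<bar> ^ DIM('a) *\<^sub>R (\<integral>x. f (t + c *\<^sub>R x) \<partial>lborel)"
proof (cases "integrable lborel f")
  case True
  then have [measurable]: "f \<in> borel_measurable borel" by auto
  have "integrable lborel (\<lambda>x. f (t + c *\<^sub>R x))" by (rule integrable_lborel_affine[OF True c])
  then show ?thesis
    by (subst lborel_affine[OF c, of t]) (simp add: integral_density integral_distr)
next
  case False
  have "\<not> integrable lborel (\<lambda>x. f (t + c *\<^sub>R x))"
  proof
    assume "integrable lborel (\<lambda>x. f (t + c *\<^sub>R x))"
    from integrable_lborel_affine[OF this, of "1 / c" "- (1 / c) *\<^sub>R t"] c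
    have "integrable lborel f" by (simp add: scaleR_right_diff_distrib)
    then show False using False by simp
  qed
  then show ?thesis using False by (simp add: not_integrable_integral_eq)
qed

lemma integral_lborel_translate:
  fixes f :: "'a::euclidean_space \<Rightarrow> 'b::{banach,second_countable_topology}"
  shows "(\<integral>x. f (x - a) \<partial>lborel) = (\<integral>x. f x \<partial>lborel)"
  using integral_lborel_affine[of 1 f "- a"] by simp

lemma integral_lborel_reflect:
  fixes f :: "'a::euclidean_space \<Rightarrow> 'b::{banach,second_countable_topology}"
  shows "(\<integral>x. f (a - x) \<partial>lborel) = (\<integral>x. f x \<partial>lborel)"
  using integral_lborel_affine[of "-1" f a] by simp

section \<open>The inverse Fourier transform of a test function\<close>

lemma borel_measurable_cis [measurable]: "cis \<in> borel_measurable borel"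
  by (intro borel_measurable_continuous_onI continuous_intros)

lemma integrable_cis_mult:
  assumes "integrable lborel h" and [measurable]: "g \<in> borel_measurable borel"
  shows "integrable lborel (\<lambda>\<xi>::'a::euclidean_space. cis (g \<xi>) * h \<xi>)"
proof -
  have [measurable]: "h \<in> borel_measurable borel" using assms(1) by auto
  show ?thesis
    by (rule Bochner_Integration.integrable_bound[OF assms(1)]) (auto simp: norm_mult)
qed

lemma integrable_cis_inner:
  "integrable lborel h \<Longrightarrow> integrable lborel (\<lambda>\<xi>::'a::euclidean_space. cis (x \<bullet> \<xi>) * h \<xi>)"
  by (rule integrable_cis_mult) auto

abbreviation inv_const :: "'n::finite itself \<Rightarrow> real" where
  "inv_const _ \<equiv> 1 / (2 * pi) ^ CARD('n)"

lemma norm_inv_fourier_le: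
  fixes h :: "real^'n::finite \<Rightarrow> complex"
  shows "norm (inv_fourier h x) \<le> inv_const TYPE('n) * (\<integral>\<xi>. norm (h \<xi>) \<partial>lborel)"
proof -
  have "norm (\<integral>\<xi>. cis (x \<bullet> \<xi>) * h \<xi> \<partial>lborel) \<le> (\<integral>\<xi>. norm (h \<xi>) \<partial>lborel)"
    using integral_norm_bound[of lborel "\<lambda>\<xi>. cis (x \<bullet> \<xi>) * h \<xi>"] by (simp add: norm_mult)
  then show ?thesis
    unfolding inv_fourier_def norm_mult norm_of_real by (simp add: divide_right_mono)
qed

lemma inv_fourier_translate:
  "inv_fourier (\<lambda>\<xi>. h (\<xi> - a)) x = cis (x \<bullet> a) * inv_fourier h x"
proof -
  have "(\<integral>\<xi>. cis (x \<bullet> \<xi>) * h (\<xi> - a) \<partial>lborel) = (\<integral>\<xi>. cis (x \<bullet> ((\<xi> - a) + a)) * h (\<xi> - a) \<partial>lborel)"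
    by simp
  also have "\<dots> = (\<integral>\<xi>. cis (x \<bullet> (\<xi> + a)) * h \<xi> \<partial>lborel)"
    by (rule integral_lborel_translate[of "\<lambda>\<xi>. cis (x \<bullet> (\<xi> + a)) * h \<xi>"])
  also have "\<dots> = cis (x \<bullet> a) * (\<integral>\<xi>. cis (x \<bullet> \<xi>) * h \<xi> \<partial>lborel)"
    by (simp add: inner_right_distrib cis_mult[symmetric] mult_ac flip: integral_mult_right_zero)
  finally show ?thesis by (simp add: inv_fourier_def)
qed

lemma inv_fourier_cmult: "inv_fourier (\<lambda>\<xi>. c * h \<xi>) x = c * inv_fourier h x"
  by (simp add: inv_fourier_def mult.left_commute[of _ c])

lemma inv_fourier_add:
  assumes "integrable lborel f" "integrable lborel g"
  shows "inv_fourier (\<lambda>\<xi>. f \<xi> + g \<xi>) x = inv_fourier f x + inv_fourier g x"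
  using assms by (simp add: inv_fourier_def integrable_cis_inner distrib_left)

lemma inv_fourier_diff:
  assumes "integrable lborel f" "integrable lborel g"
  shows "inv_fourier (\<lambda>\<xi>. f \<xi> - g \<xi>) x = inv_fourier f x - inv_fourier g x"
  using assms by (simp add: inv_fourier_def integrable_cis_inner right_diff_distrib)

lemma test_function_cmult: "test_function h \<Longrightarrow> test_function (\<lambda>\<xi>. c * h \<xi>)"
  by (rule test_function_mult[OF smooth_const])

lemma test_function_inner_mult:
  assumes "test_function h"
  shows "test_function (\<lambda>\<xi>. \<i> * complex_of_real (v \<bullet> \<xi>) * h \<xi>)"
proof (rule test_function_mult[OF smooth_linear assms])
  show "bounded_linear (\<lambda>\<xi>. \<i> * complex_of_real (v \<bullet> \<xi>))"
    by (intro bounded_linear_const_mult bounded_linear_compose[OF bounded_linear_of_real]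
        bounded_linear_inner_right)
qed

text \<open>The differentiability criterion behind differentiation under the Fourier integral: for the
phases the Taylor remainder is quadratic, uniformly in the base point.\<close>

lemma has_derivative_quadratic_remainder:
  assumes D: "bounded_linear D" and rem: "\<And>v. norm (f (x + v) - f x - D v) \<le> C * (norm v)\<^sup>2"
  shows "(f has_derivative D) (at x)"
  unfolding has_derivative_at
proof
  show "(\<lambda>h. norm (f (x + h) - f x - D h) / norm h) \<midarrow>0\<rightarrow> 0"
  proof (rule tendsto_sandwich[where f = "\<lambda>_. 0" and h = "\<lambda>h. C * norm h"])
    have "norm (f (x + h) - f x - D h) / norm h \<le> C * norm h" for h
      using rem[of h] by (cases "h = 0") (auto simp: field_simps power2_eq_square)
    then show "\<forall>\<^sub>F h in at 0. norm (f (x + h) - f x - D h) / norm h \<le> C * norm h" by simp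
    show "(\<lambda>h. C * norm h) \<midarrow>0\<rightarrow> 0" by (auto intro!: tendsto_eq_intros)
  qed auto
qed (rule D)

lemma norm_cis_taylor: "norm (cis t - 1 - \<i> * complex_of_real t) \<le> t\<^sup>2 / 2"
  using iexp_approx1[of t 1] by (simp add: cis_conv_exp power2_eq_square diff_diff_eq)

lemma has_derivative_inv_fourier:
  fixes h :: "real^'n::finite \<Rightarrow> complex"
  assumes h: "test_function h"
  shows "(inv_fourier h has_derivative
    (\<lambda>v. inv_fourier (\<lambda>\<xi>. \<i> * complex_of_real (v \<bullet> \<xi>) * h \<xi>) x)) (at x)"
proof (rule has_derivative_quadratic_remainder)
  note int = test_function_integrable[OF h] test_function_integrable[OF test_function_inner_mult[OF h]]
  show "bounded_linear (\<lambda>v. inv_fourier (\<lambda>\<xi>. \<i> * complex_of_real (v \<bullet> \<xi>) * h \<xi>) x)"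
    unfolding linear_conv_bounded_linear[symmetric]
  proof
    fix v w r
    show "inv_fourier (\<lambda>\<xi>. \<i> * complex_of_real ((v + w) \<bullet> \<xi>) * h \<xi>) x =
      inv_fourier (\<lambda>\<xi>. \<i> * complex_of_real (v \<bullet> \<xi>) * h \<xi>) x + inv_fourier (\<lambda>\<xi>. \<i> * complex_of_real (w \<bullet> \<xi>) * h \<xi>) x"
      using inv_fourier_add[OF int(2)[of v] int(2)[of w], of x] by (simp add: inner_left_distrib algebra_simps)
    show "inv_fourier (\<lambda>\<xi>. \<i> * complex_of_real ((r *\<^sub>R v) \<bullet> \<xi>) * h \<xi>) x =
      r *\<^sub>R inv_fourier (\<lambda>\<xi>. \<i> * complex_of_real (v \<bullet> \<xi>) * h \<xi>) x"
      using inv_fourier_cmult[of "complex_of_real r" "\<lambda>\<xi>. \<i> * complex_of_real (v \<bullet> \<xi>) * h \<xi>" x]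
      by (simp add: mult_ac scaleR_conv_of_real[where 'a = complex])
  qed
  have meas [measurable]: "h \<in> borel_measurable borel" using int(1) by auto
  obtain R where R: "\<And>\<xi>. norm \<xi> > R \<Longrightarrow> h \<xi> = 0" using h test_function_def by blast
  let ?C = "inv_const TYPE('n) * (\<integral>\<xi>. (norm \<xi>)\<^sup>2 / 2 * norm (h \<xi>) \<partial>lborel)"
  have int2: "integrable lborel (\<lambda>\<xi>. (norm \<xi>)\<^sup>2 / 2 * norm (h \<xi>))"
    by (rule integrable_continuous_compact_support[where R = R])
       (use R test_function_continuous[OF h] in \<open>auto intro!: continuous_intros\<close>)
  fix v
  let ?E = "\<lambda>\<xi>. (cis (v \<bullet> \<xi>) - 1 - \<i> * complex_of_real (v \<bullet> \<xi>)) * h \<xi>"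
  have "inv_fourier h (x + v) - inv_fourier h x - inv_fourier (\<lambda>\<xi>. \<i> * complex_of_real (v \<bullet> \<xi>) * h \<xi>) x
    = inv_fourier ?E x"
  proof -
    have 1: "inv_fourier h (x + v) = inv_fourier (\<lambda>\<xi>. cis (v \<bullet> \<xi>) * h \<xi>) x"
      by (simp add: inv_fourier_def inner_left_distrib cis_mult[symmetric] mult_ac)
    have 2: "integrable lborel (\<lambda>\<xi>. cis (v \<bullet> \<xi>) * h \<xi>)" by (rule integrable_cis_inner[OF int(1)])
    show ?thesis
      unfolding 1 inv_fourier_diff[OF 2 int(1), symmetric]
        inv_fourier_diff[OF Bochner_Integration.integrable_diff[OF 2 int(1)] int(2), symmetric]
      by (simp add: left_diff_distrib)
  qed
  also have "norm \<dots> \<le> inv_const TYPE('n) * (\<integral>\<xi>. norm (?E \<xi>) \<partial>lborel)"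
    by (rule norm_inv_fourier_le)
  also have "(\<integral>\<xi>. norm (?E \<xi>) \<partial>lborel) \<le> (\<integral>\<xi>. (norm v)\<^sup>2 * ((norm \<xi>)\<^sup>2 / 2 * norm (h \<xi>)) \<partial>lborel)"
  proof (rule integral_mono_AE')
    show "integrable lborel (\<lambda>\<xi>. (norm v)\<^sup>2 * ((norm \<xi>)\<^sup>2 / 2 * norm (h \<xi>)))" by (rule integrable_mult_right[OF int2])
    have "norm (?E \<xi>) \<le> (norm v)\<^sup>2 * ((norm \<xi>)\<^sup>2 / 2 * norm (h \<xi>))" for \<xi>
    proof -
      have "norm (cis (v \<bullet> \<xi>) - 1 - \<i> * complex_of_real (v \<bullet> \<xi>)) \<le> (v \<bullet> \<xi>)\<^sup>2 / 2" by (rule norm_cis_taylor)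
      also have "\<dots> \<le> (norm v * norm \<xi>)\<^sup>2 / 2"
        using power_mono[OF Cauchy_Schwarz_ineq2[of v \<xi>], of 2] by simp
      finally have "norm (cis (v \<bullet> \<xi>) - 1 - \<i> * complex_of_real (v \<bullet> \<xi>)) * norm (h \<xi>)
         \<le> (norm v * norm \<xi>)\<^sup>2 / 2 * norm (h \<xi>)" by (rule mult_right_mono) simp
      then show ?thesis by (simp add: norm_mult power_mult_distrib mult_ac)
    qed
    then show "AE \<xi> in lborel. norm (?E \<xi>) \<le> (norm v)\<^sup>2 * ((norm \<xi>)\<^sup>2 / 2 * norm (h \<xi>))" by simp
  qed simp
  also have "\<dots> = (norm v)\<^sup>2 * (\<integral>\<xi>. (norm \<xi>)\<^sup>2 / 2 * norm (h \<xi>) \<partial>lborel)" by simp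
  finally show "norm (inv_fourier h (x + v) - inv_fourier h x - inv_fourier (\<lambda>\<xi>. \<i> * complex_of_real (v \<bullet> \<xi>) * h \<xi>) x)
    \<le> ?C * (norm v)\<^sup>2" by (simp add: mult_left_mono divide_right_mono mult_ac)
qed

lemma partial_deriv_inv_fourier:
  assumes h: "test_function h"
  shows "partial_deriv k (inv_fourier h) = inv_fourier (\<lambda>\<xi>. \<i> * complex_of_real (\<xi> $ k) * h \<xi>)"
  using partial_deriv_eqI[OF has_derivative_inv_fourier[OF h]]
  by (auto simp: inner_axis' )

lemma has_vector_derivative_quotient_sequence:
  assumes f: "(f has_vector_derivative y) (at x)" and t: "t \<longlonglongrightarrow> 0" "\<And>n. t n \<noteq> 0"
  shows "(\<lambda>n. (f (x + t n) - f x) /\<^sub>R t n) \<longlonglongrightarrow> y"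
proof -
  have "(\<lambda>h. norm (f (x + h) - f x - h *\<^sub>R y) / norm h) \<midarrow>0\<rightarrow> 0"
    using f by (simp add: has_vector_derivative_def has_derivative_at)
  then have "(\<lambda>n. norm (f (x + t n) - f x - t n *\<^sub>R y) / norm (t n)) \<longlonglongrightarrow> 0"
    using t by (auto simp: tendsto_at_iff_sequentially o_def)
  moreover have "norm (f (x + t n) - f x - t n *\<^sub>R y) / norm (t n) = norm ((f (x + t n) - f x) /\<^sub>R t n - y)" for n
  proof -
    have "(f (x + t n) - f x) /\<^sub>R t n - y = (f (x + t n) - f x - t n *\<^sub>R y) /\<^sub>R t n"
      using t(2)[of n] by (simp add: scaleR_right_diff_distrib)
    then show ?thesis by (simp add: divide_inverse mult.commute)
  qed
  ultimately show ?thesis by (simp add: LIM_zero_iff tendsto_norm_zero_iff)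
qed

text \<open>Multiplication by a coordinate is differentiation of the symbol.  Instead of integrating by parts, compare the
difference quotients of \<open>h\<close> in direction \<open>k\<close> with those of the phase: translating \<open>h\<close> by \<open>t\<close> multiplies the
inverse transform by \<open>cis (t x_k)\<close>, and \<open>t\<close> tends to \<open>0\<close> on both sides.\<close>

lemma inv_fourier_coord:
  fixes h :: "real^'n::finite \<Rightarrow> complex"
  assumes h: "test_function h"
  shows "complex_of_real (x $ k) * inv_fourier h x = \<i> * inv_fourier (partial_deriv k h) x"
proof -
  let ?e = "axis k 1 :: real^'n"
  let ?t = "\<lambda>n. 1 / real (Suc n)"
  define q where "q n \<xi> = (h (\<xi> - ?t n *\<^sub>R ?e) - h \<xi>) /\<^sub>R ?t n" for n \<xi>
  have t: "?t \<longlonglongrightarrow> 0" by (rule LIMSEQ_Suc[OF lim_1_over_n])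
  note hD = has_derivative_frechet[OF smooth_differentiable]
  \<comment> \<open>Along the line through \<open>\<xi>\<close> in direction \<open>- e_k\<close>, which covers both the limit and the bound of the quotients.\<close>
  have path: "((\<lambda>s. h (\<xi> - s *\<^sub>R ?e)) has_vector_derivative - partial_deriv k h (\<xi> - s *\<^sub>R ?e)) (at s)" for \<xi> s
  proof -
    have "((\<lambda>s. \<xi> - s *\<^sub>R ?e) has_derivative (\<lambda>r. - r *\<^sub>R ?e)) (at s)"
      by (auto intro!: derivative_eq_intros)
    from diff_chain_at[OF this hD, of h] h
    have "((\<lambda>s. h (\<xi> - s *\<^sub>R ?e)) has_derivative
       (\<lambda>r. frechet_derivative h (at (\<xi> - s *\<^sub>R ?e)) (- r *\<^sub>R ?e))) (at s)"
      by (simp add: o_def test_function_def)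
    moreover have "frechet_derivative h (at y) (- r *\<^sub>R ?e) = r *\<^sub>R - partial_deriv k h y" for y r
      using linear_cmul[OF linear_frechet_derivative[OF smooth_differentiable[of h y]], of "- r" ?e] h
      by (simp add: test_function_def partial_deriv_def)
    ultimately show ?thesis
      by (simp only: has_vector_derivative_def)
  qed
  obtain R where R: "\<And>\<xi>. norm \<xi> > R \<Longrightarrow> h \<xi> = 0" using h test_function_def by blast
  obtain B where B: "\<And>\<xi>. norm (partial_deriv k h \<xi>) \<le> B"
    using test_function_bounded[OF test_function_partial_deriv[OF h]] by metis
  \<comment> \<open>The quotients are bounded by the mean value inequality and vanish outside a ball of radius \<open>R + 1\<close>.\<close>
  have "(\<lambda>n. \<integral>\<xi>. cis (x \<bullet> \<xi>) * q n \<xi> \<partial>lborel) \<longlonglongrightarrow> (\<integral>\<xi>. cis (x \<bullet> \<xi>) * - partial_deriv k h \<xi> \<partial>lborel)"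
  proof (rule integral_dominated_convergence)
    have [measurable]: "h \<in> borel_measurable borel" "partial_deriv k h \<in> borel_measurable borel"
      using test_function_continuous[OF h] test_function_continuous[OF test_function_partial_deriv[OF h]]
      by (auto intro: borel_measurable_continuous_onI)
    show "(\<lambda>\<xi>. cis (x \<bullet> \<xi>) * - partial_deriv k h \<xi>) \<in> borel_measurable lborel"
      "(\<lambda>\<xi>. cis (x \<bullet> \<xi>) * q n \<xi>) \<in> borel_measurable lborel" for n
      unfolding q_def by measurable
    show "integrable lborel (\<lambda>\<xi>. B * indicator (cball (0::real^'n) (R + 1)) \<xi>)"
      using emeasure_bounded_finite[OF bounded_cball, of "0::real^'n" "R + 1"]
      by (intro integrable_mult_right integrable_real_indicator) auto
    have "(\<lambda>n. q n \<xi>) \<longlonglongrightarrow> - partial_deriv k h \<xi>" for \<xi>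
      using has_vector_derivative_quotient_sequence[OF path[of \<xi> 0] t] by (simp add: q_def)
    then show "AE \<xi> in lborel. (\<lambda>n. cis (x \<bullet> \<xi>) * q n \<xi>) \<longlonglongrightarrow> cis (x \<bullet> \<xi>) * - partial_deriv k h \<xi>"
      by (intro AE_I2 tendsto_mult tendsto_const)
    fix n
    have "norm (q n \<xi>) \<le> B * indicator (cball (0::real^'n) (R + 1)) \<xi>" for \<xi>
    proof (cases "\<xi> \<in> cball 0 (R + 1)")
      case True
      have "norm (h (\<xi> - ?t n *\<^sub>R ?e) - h (\<xi> - 0 *\<^sub>R ?e)) \<le> B * norm (?t n - 0)"
      proof (rule differentiable_bound[where S = UNIV])
        show "((\<lambda>s. h (\<xi> - s *\<^sub>R ?e)) has_derivative (\<lambda>r. r *\<^sub>R - partial_deriv k h (\<xi> - s *\<^sub>R ?e))) (at s)" for s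
          using path[of \<xi> s] by (simp add: has_vector_derivative_def)
        show "onorm (\<lambda>r. r *\<^sub>R - partial_deriv k h (\<xi> - s *\<^sub>R ?e)) \<le> B" for s
          by (rule onorm_le) (use mult_right_mono[OF B abs_ge_zero] in \<open>simp add: mult.commute\<close>)
      qed auto
      moreover have "norm (q n \<xi>) = norm (h (\<xi> - ?t n *\<^sub>R ?e) - h (\<xi> - 0 *\<^sub>R ?e)) / ?t n"
        by (simp add: q_def)
      ultimately show ?thesis using True by (simp add: pos_divide_le_eq del: divide_divide_eq_right)
    next
      case False
      have "norm (?t n *\<^sub>R ?e) \<le> 1" by (simp add: norm_axis_1)
      moreover have "norm \<xi> > R + 1" using False by simp
      ultimately have "norm (\<xi> - ?t n *\<^sub>R ?e) > R" "norm \<xi> > R"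
        using norm_triangle_ineq2[of \<xi> "?t n *\<^sub>R ?e"] by linarith+
      then show ?thesis using R False by (simp add: q_def)
    qed
    then show "AE \<xi> in lborel. norm (cis (x \<bullet> \<xi>) * q n \<xi>) \<le> B * indicator (cball 0 (R + 1)) \<xi>"
      by (simp add: norm_mult)
  qed
  from tendsto_mult[OF tendsto_const[of "complex_of_real (inv_const TYPE('n))"] this]
  have L: "(\<lambda>n. inv_fourier (q n) x) \<longlonglongrightarrow> - inv_fourier (partial_deriv k h) x"
    by (simp add: inv_fourier_def)
  have "inv_fourier (q n) x = ((cis (?t n * x $ k) - 1) /\<^sub>R ?t n) * inv_fourier h x" for n
  proof -
    have q: "q n = (\<lambda>\<xi>. complex_of_real (1 / ?t n) * (h (\<xi> - ?t n *\<^sub>R ?e) - h \<xi>))"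
      by (auto simp: q_def scaleR_conv_of_real)
    show ?thesis unfolding q inv_fourier_cmult
      by (subst inv_fourier_diff)
         (simp_all add: h test_function_integrable test_function_translate inv_fourier_translate
            inner_axis scaleR_conv_of_real[where 'a = complex] left_diff_distrib right_diff_distrib mult_ac)
  qed
  moreover have "(\<lambda>n. (cis (?t n * x $ k) - 1) /\<^sub>R ?t n) \<longlonglongrightarrow> \<i> * x $ k"
  proof -
    have "((\<lambda>s. cis (s * x $ k)) has_vector_derivative \<i> * x $ k) (at 0)"
      unfolding has_vector_derivative_def
      by (auto intro!: derivative_eq_intros simp: scaleR_conv_of_real)
    from has_vector_derivative_quotient_sequence[OF this t] show ?thesis by simp
  qed
  ultimately have "(\<lambda>n. inv_fourier (q n) x) \<longlonglongrightarrow> \<i> * x $ k * inv_fourier h x"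
    by (simp only: tendsto_mult[OF _ tendsto_const])
  from LIMSEQ_unique[OF this L] have "\<i> * (\<i> * x $ k * inv_fourier h x) = \<i> * (- inv_fourier (partial_deriv k h) x)"
    by simp
  then show ?thesis by (simp add: mult.assoc[symmetric])
qed

text \<open>Each power of \<open>norm x\<close> is dominated by the sum of the coordinates, and each coordinate
is traded for one derivative of the test function.\<close>

lemma inv_fourier_test_bounded:
  fixes h :: "real^'n::finite \<Rightarrow> complex"
  assumes "test_function h"
  shows "\<exists>C. \<forall>x. norm x ^ m * norm (inv_fourier h x) \<le> C"
  using assms
proof (induction m arbitrary: h)
  case 0
  then show ?case using norm_inv_fourier_le[of h] by auto
next
  case (Suc m)
  have "\<exists>C. \<forall>x. norm x ^ m * norm (inv_fourier (partial_deriv k h) x) \<le> C" for k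
    by (rule Suc.IH[OF test_function_partial_deriv[OF Suc.prems]])
  then obtain C where C: "\<And>k x. norm x ^ m * norm (inv_fourier (partial_deriv k h) x) \<le> C k" by metis
  have "norm x ^ Suc m * norm (inv_fourier h x) \<le> (\<Sum>k\<in>UNIV. C k)" for x
  proof -
    have "norm x ^ Suc m * norm (inv_fourier h x) = norm x * (norm x ^ m * norm (inv_fourier h x))" by simp
    also have "\<dots> \<le> (\<Sum>k\<in>UNIV. \<bar>x $ k\<bar>) * (norm x ^ m * norm (inv_fourier h x))"
      by (intro mult_right_mono norm_le_l1_cart) simp
    also have "\<dots> = (\<Sum>k\<in>UNIV. norm x ^ m * norm (complex_of_real (x $ k) * inv_fourier h x))"
      by (simp add: sum_distrib_left sum_distrib_right norm_mult mult_ac)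
    also have "\<dots> = (\<Sum>k\<in>UNIV. norm x ^ m * norm (inv_fourier (partial_deriv k h) x))"
      by (simp add: inv_fourier_coord[OF Suc.prems] norm_mult)
    also have "\<dots> \<le> (\<Sum>k\<in>UNIV. C k)" by (intro sum_mono C)
    finally show ?thesis .
  qed
  then show ?case by blast
qed

lemma schwartz_inv_fourier:
  assumes "test_function h"
  shows "schwartz (inv_fourier h)"
proof (rule schwartz_coinduct[where P = "\<lambda>u. \<exists>h. test_function h \<and> u = inv_fourier h"])
  fix u :: "real^'a \<Rightarrow> complex" and k x m assume "\<exists>h. test_function h \<and> u = inv_fourier h"
  then obtain h where h: "test_function h" "u = inv_fourier h" by blast
  show "u differentiable (at x)"
    unfolding h(2) by (rule differentiableI[OF has_derivative_inv_fourier[OF h(1)]])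
  have "test_function (\<lambda>\<xi>. \<i> * complex_of_real (\<xi> $ k) * h \<xi>)"
    using test_function_inner_mult[OF h(1), of "axis k 1"] by (simp add: inner_axis')
  then show "\<exists>h. test_function h \<and> partial_deriv k u = inv_fourier h"
    unfolding h(2) partial_deriv_inv_fourier[OF h(1)] by blast
  show "bounded (range (\<lambda>x. norm x ^ m *\<^sub>R u x))"
    using inv_fourier_test_bounded[OF h(1), of m] by (auto simp: bounded_iff h(2) norm_mult norm_power)
qed (use assms in blast)

section \<open>Integrability of Schwartz functions\<close>

lemma integrable_one_over_one_plus_square: "integrable lborel (\<lambda>x::real. 1 / (1 + x\<^sup>2))"
proof -
  have "set_integrable lborel (einterval (-\<infinity>) \<infinity>) (\<lambda>x::real. 1 / (1 + x\<^sup>2))"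
  proof (rule interval_integral_FTC_nonneg(1)[where F = arctan and A = "-pi/2" and B = "pi/2"])
    show "DERIV arctan x :> 1 / (1 + x\<^sup>2)" for x
      by (auto intro!: derivative_eq_intros simp: inverse_eq_divide)
    show "isCont (\<lambda>x. 1 / (1 + x\<^sup>2)) x" for x :: real
      by (auto intro!: continuous_intros simp: add_nonneg_eq_0_iff)
    show "((arctan \<circ> real_of_ereal) \<longlongrightarrow> - pi / 2) (at_right (- \<infinity>))"
      using tendsto_arctan_at_bot by (simp add: ereal_tendsto_simps)
    show "((arctan \<circ> real_of_ereal) \<longlongrightarrow> pi / 2) (at_left \<infinity>)"
      using tendsto_arctan_at_top by (simp add: ereal_tendsto_simps)
  qed auto
  then show ?thesis by (simp add: set_integrable_def)
qed

lemma
  fixes f :: "'a::euclidean_space \<Rightarrow> real \<Rightarrow> 'b::{real_normed_field,banach,second_countable_topology}"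
  assumes f: "\<And>b. b \<in> Basis \<Longrightarrow> integrable lborel (f b)"
  shows integrable_lborel_prod: "integrable lborel (\<lambda>x. \<Prod>b\<in>Basis. f b (x \<bullet> b))"
    and integral_lborel_prod: "(\<integral>x. (\<Prod>b\<in>Basis. f b (x \<bullet> b)) \<partial>lborel) = (\<Prod>b\<in>Basis. \<integral>t. f b t \<partial>lborel)"
proof -
  interpret P: product_sigma_finite "\<lambda>_::'a. lborel :: real measure" ..
  have [measurable]: "f b \<in> borel_measurable borel" if "b \<in> Basis" for b using f[OF that] by auto
  have *: "(\<lambda>x. \<Prod>b\<in>Basis. f b (x \<bullet> b)) \<in> borel_measurable borel" by measurable
  have coord: "(\<Sum>b\<in>Basis. x b *\<^sub>R b) \<bullet> b' = x b'" if "b' \<in> Basis" for x and b' :: 'a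
    using that by (simp add: inner_sum_left inner_Basis if_distrib sum.delta cong: if_cong)
  have prod: "(\<Prod>b\<in>Basis. f b ((\<Sum>b\<in>Basis. x b *\<^sub>R b) \<bullet> b)) = (\<Prod>b\<in>Basis. f b (x b))" for x
    by (rule prod.cong) (simp_all add: coord)
  show "integrable lborel (\<lambda>x. \<Prod>b\<in>Basis. f b (x \<bullet> b))"
    by (subst lborel_eq, subst integrable_distr_eq[OF _ *])
       (simp_all add: prod P.product_integrable_prod f)
  show "(\<integral>x. (\<Prod>b\<in>Basis. f b (x \<bullet> b)) \<partial>lborel) = (\<Prod>b\<in>Basis. \<integral>t. f b t \<partial>lborel)"
    by (subst lborel_eq, subst integral_distr[OF _ *])
       (simp_all add: prod P.product_integral_prod f)
qed

text \<open>Rapid decay gives a bound by a product of the one-dimensional integrable functions \<open>1 / (1 + t^2)\<close>.\<close>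

lemma schwartz_integrable:
  fixes u :: "real^'n::finite \<Rightarrow> 'b::{banach,second_countable_topology,real_normed_vector}"
  assumes u: "schwartz u"
  shows "integrable lborel u"
proof -
  let ?d = "DIM(real^'n)"
  have "\<exists>C. \<forall>x. norm x ^ m * norm (u x) \<le> C" for m
    using schwartz_bounded[OF u, of m] by (auto simp: bounded_iff norm_power)
  then obtain C where C: "\<And>m x. norm x ^ m * norm (u x) \<le> C m" by metis
  define K where "K = 2 ^ ?d * (C 0 + C (2 * ?d))"
  \<comment> \<open>The product of the \<open>1 + (x \<bullet> b)^2\<close> has degree \<open>2 d\<close>, so the seminorms of order \<open>0\<close> and \<open>2 d\<close> suffice.\<close>
  have bound: "norm (u x) \<le> K * (\<Prod>b\<in>Basis. 1 / (1 + (x \<bullet> b)\<^sup>2))" for x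
  proof -
    have pos: "(\<Prod>b\<in>Basis. 1 + (x \<bullet> b)\<^sup>2) > 0" by (intro prod_pos) (simp add: add_pos_nonneg)
    have "(\<Prod>b\<in>Basis. 1 + (x \<bullet> b)\<^sup>2) \<le> (\<Prod>b\<in>(Basis :: (real^'n) set). 1 + (norm x)\<^sup>2)"
      using Basis_le_norm[of _ x] by (intro prod_mono) (auto simp: abs_le_square_iff[symmetric])
    also have "\<dots> = (1 + (norm x)\<^sup>2) ^ ?d" by (simp only: prod_constant)
    also have "\<dots> \<le> (2 * max 1 ((norm x)\<^sup>2)) ^ ?d" by (intro power_mono) auto
    also have "\<dots> = 2 ^ ?d * max 1 ((norm x)\<^sup>2) ^ ?d" by (rule power_mult_distrib)
    also have "max 1 ((norm x)\<^sup>2) ^ ?d \<le> 1 + norm x ^ (2 * ?d)"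
      by (cases "1 \<le> (norm x)\<^sup>2") (auto simp: max_def power_mult)
    finally have "(\<Prod>b\<in>Basis. 1 + (x \<bullet> b)\<^sup>2) * norm (u x) \<le> 2 ^ ?d * (1 + norm x ^ (2 * ?d)) * norm (u x)"
      by (simp add: mult_right_mono)
    also have "\<dots> \<le> K"
      using C[of x 0] C[of x "2 * ?d"] by (simp add: K_def distrib_right)
    finally show ?thesis
      using pos by (simp add: prod_dividef field_simps)
  qed
  have "continuous_on UNIV u" using u smooth_continuous by (auto simp: schwartz_def)
  then have [measurable]: "u \<in> borel_measurable borel" by (rule borel_measurable_continuous_onI)
  show ?thesis
  proof (rule Bochner_Integration.integrable_bound)
    show "integrable lborel (\<lambda>x::real^'n. K * (\<Prod>b\<in>Basis. 1 / (1 + (x \<bullet> b)\<^sup>2)))"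
      using integrable_lborel_prod[of "\<lambda>_ t. 1 / (1 + t\<^sup>2)"] integrable_one_over_one_plus_square
      by (intro integrable_mult_right) blast
    show "AE x in lborel. norm (u x) \<le> norm (K * (\<Prod>b\<in>Basis. 1 / (1 + (x \<bullet> b)\<^sup>2)))"
      using bound by (intro AE_I2) (smt (verit) real_norm_def)
  qed simp
qed

section \<open>Fourier inversion\<close>

lemma integrable_pair_product_bound:
  fixes F :: "'a::euclidean_space \<Rightarrow> 'b::euclidean_space \<Rightarrow> complex"
  assumes [measurable]: "case_prod F \<in> borel_measurable (borel \<Otimes>\<^sub>M borel)"
    and g: "integrable lborel g" and k: "integrable lborel k"
    and bound: "\<And>x y. norm (F x y) \<le> norm (g x :: complex) * norm (k y :: complex)"
  shows "integrable (lborel \<Otimes>\<^sub>M lborel) (case_prod F)"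
proof (rule Bochner_Integration.integrable_bound)
  have [measurable]: "g \<in> borel_measurable borel" "k \<in> borel_measurable borel" using g k by auto
  show "integrable (lborel \<Otimes>\<^sub>M lborel) (\<lambda>(x, y). g x * k y)"
  proof (rule lborel_pair.Fubini_integrable)
    show "integrable lborel (\<lambda>x. \<integral>y. norm (case (x, y) of (x, y) \<Rightarrow> g x * k y) \<partial>lborel)"
      using g by (simp add: norm_mult)
    show "AE x in lborel. integrable lborel (\<lambda>y. case (x, y) of (x, y) \<Rightarrow> g x * k y)"
      using k by simp
  qed measurable
  show "AE z in lborel \<Otimes>\<^sub>M lborel. norm (case_prod F z) \<le> norm (case z of (x, y) \<Rightarrow> g x * k y)"
    using bound by (auto simp: norm_mult)
qed measurable

lemma
  shows integrable_gaussian: "integrable lborel (\<lambda>t::real. cis (t * u) * complex_of_real (exp (- t\<^sup>2 / 2)))"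
    and integral_gaussian_cis: "(\<integral>t. cis (t * u) * complex_of_real (exp (- t\<^sup>2 / 2)) \<partial>lborel)
      = complex_of_real (sqrt (2 * pi) * exp (- u\<^sup>2 / 2))"
proof -
  have dens: "exp (- t\<^sup>2 / 2) = sqrt (2 * pi) * std_normal_density t" for t :: real
    by (simp add: std_normal_density_def)
  have "integrable lborel (\<lambda>t::real. complex_of_real (exp (- t\<^sup>2 / 2)))"
    unfolding dens using integrable_std_normal_moment[of 0] by simp
  then show "integrable lborel (\<lambda>t::real. cis (t * u) * complex_of_real (exp (- t\<^sup>2 / 2)))"
    by (rule integrable_cis_mult) simp
  have "char std_normal_distribution u = (\<integral>t. std_normal_density t *\<^sub>R cis (t * u) \<partial>lborel)"
    unfolding char_def by (subst integral_density) (auto simp: normal_density_nonneg cis_conv_exp mult_ac)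
  then have "(\<integral>t. std_normal_density t *\<^sub>R cis (t * u) \<partial>lborel) = complex_of_real (exp (- u\<^sup>2 / 2))"
    by (simp add: char_std_normal_distribution)
  then show "(\<integral>t. cis (t * u) * complex_of_real (exp (- t\<^sup>2 / 2)) \<partial>lborel)
      = complex_of_real (sqrt (2 * pi) * exp (- u\<^sup>2 / 2))"
  proof -
    assume *: "(\<integral>t. std_normal_density t *\<^sub>R cis (t * u) \<partial>lborel) = complex_of_real (exp (- u\<^sup>2 / 2))"
    have "(\<integral>t. cis (t * u) * complex_of_real (exp (- t\<^sup>2 / 2)) \<partial>lborel)
      = (\<integral>t. complex_of_real (sqrt (2 * pi)) * (std_normal_density t *\<^sub>R cis (t * u)) \<partial>lborel)"
      by (rule Bochner_Integration.integral_cong) (simp_all only: dens of_real_mult scaleR_conv_of_real mult_ac)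
    then show ?thesis by (simp only: integral_mult_right_zero * of_real_mult)
  qed
qed

lemma
  fixes u :: "'a::euclidean_space"
  shows integrable_gaussian_euclidean:
      "integrable lborel (\<lambda>x. cis (x \<bullet> u) * complex_of_real (exp (- (norm x)\<^sup>2 / 2)))"
    and integral_gaussian_euclidean: "(\<integral>x. cis (x \<bullet> u) * complex_of_real (exp (- (norm x)\<^sup>2 / 2)) \<partial>lborel)
      = complex_of_real (sqrt (2 * pi) ^ DIM('a) * exp (- (norm u)\<^sup>2 / 2))"
proof -
  have normsq: "- (norm y)\<^sup>2 / 2 = (\<Sum>b\<in>Basis. - (y \<bullet> b)\<^sup>2 / 2)" for y :: 'a
    unfolding power2_norm_eq_inner euclidean_inner[of y y]
    by (simp add: power2_eq_square sum_negf flip: sum_divide_distrib)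
  have eq: "cis (x \<bullet> u) * complex_of_real (exp (- (norm x)\<^sup>2 / 2)) =
      (\<Prod>b\<in>Basis. cis ((x \<bullet> b) * (u \<bullet> b)) * complex_of_real (exp (- (x \<bullet> b)\<^sup>2 / 2)))" for x
    unfolding normsq by (simp add: euclidean_inner[of x u] cis_conv_exp exp_sum sum_distrib_left prod.distrib)
  show "integrable lborel (\<lambda>x. cis (x \<bullet> u) * complex_of_real (exp (- (norm x)\<^sup>2 / 2)))"
    unfolding eq by (intro integrable_lborel_prod integrable_gaussian)
  show "(\<integral>x. cis (x \<bullet> u) * complex_of_real (exp (- (norm x)\<^sup>2 / 2)) \<partial>lborel)
      = complex_of_real (sqrt (2 * pi) ^ DIM('a) * exp (- (norm u)\<^sup>2 / 2))"
    unfolding eq by (subst integral_lborel_prod[OF integrable_gaussian])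
      (simp only: integral_gaussian_cis normsq, simp add: exp_sum prod.distrib)
qed

text \<open>Fourier inversion with a Gaussian convergence factor.  By Fubini's theorem the Gaussian can be integrated first;
its transform is a Gaussian of width \<open>e\<close>, so that the right-hand side is an average of \<open>h\<close> around \<open>\<xi>\<close> at scale \<open>e\<close>.\<close>

lemma fourier_inv_fourier_regularized:
  fixes h :: "real^'n::finite \<Rightarrow> complex"
  assumes h: "test_function h" and e: "e > 0"
  shows "(\<integral>x. cis (- (x \<bullet> \<xi>)) * (complex_of_real (exp (- (norm (e *\<^sub>R x))\<^sup>2 / 2)) * inv_fourier h x) \<partial>lborel)
    = complex_of_real (inv_const TYPE('n) * sqrt (2 * pi) ^ CARD('n))
      * (\<integral>v. complex_of_real (exp (- (norm v)\<^sup>2 / 2)) * h (\<xi> + e *\<^sub>R v) \<partial>lborel)"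
proof -
  let ?G = "\<lambda>x::real^'n. complex_of_real (exp (- (norm x)\<^sup>2 / 2))"
  let ?F = "\<lambda>x \<eta>. cis (x \<bullet> (\<eta> - \<xi>)) * ?G (e *\<^sub>R x) * h \<eta>"
  have hint: "integrable lborel h" by (rule test_function_integrable[OF h])
  then have [measurable]: "h \<in> borel_measurable borel" by auto
  have Gint: "integrable lborel (\<lambda>x. ?G (e *\<^sub>R x))"
    using integrable_lborel_affine[of ?G e 0] integrable_gaussian_euclidean[of "0::real^'n"] e by simp
  have Fint: "integrable (lborel \<Otimes>\<^sub>M lborel) (case_prod ?F)"
    by (rule integrable_pair_product_bound[OF _ Gint hint]) (simp_all add: norm_mult)
  have inner: "(\<integral>x. cis (x \<bullet> w) * ?G (e *\<^sub>R x) \<partial>lborel)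
     = complex_of_real (sqrt (2 * pi) ^ CARD('n) / e ^ CARD('n)) * ?G (w /\<^sub>R e)" for w
  proof -
    have "complex_of_real (e ^ CARD('n)) * (\<integral>x. cis (x \<bullet> w) * ?G (e *\<^sub>R x) \<partial>lborel)
      = (\<integral>y. cis (y \<bullet> (w /\<^sub>R e)) * ?G y \<partial>lborel)"
      using integral_lborel_affine[of e "\<lambda>y. cis (y \<bullet> (w /\<^sub>R e)) * ?G y" 0] e
      by (simp add: mult.assoc[of "inverse e" e, symmetric] scaleR_conv_of_real[where 'a = complex])
    also have "\<dots> = complex_of_real (sqrt (2 * pi) ^ CARD('n)) * ?G (w /\<^sub>R e)"
      using integral_gaussian_euclidean[of "w /\<^sub>R e"] by simp
    finally show ?thesis using e by (simp add: field_simps)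
  qed
  have "(\<integral>x. cis (- (x \<bullet> \<xi>)) * (?G (e *\<^sub>R x) * inv_fourier h x) \<partial>lborel)
      = complex_of_real (inv_const TYPE('n)) * (\<integral>x. (\<integral>\<eta>. ?F x \<eta> \<partial>lborel) \<partial>lborel)"
  proof -
    have "cis (- (x \<bullet> \<xi>)) * (?G (e *\<^sub>R x) * inv_fourier h x)
      = complex_of_real (inv_const TYPE('n)) * (\<integral>\<eta>. ?F x \<eta> \<partial>lborel)" for x
    proof -
      have "?F x \<eta> = (cis (- (x \<bullet> \<xi>)) * ?G (e *\<^sub>R x)) * (cis (x \<bullet> \<eta>) * h \<eta>)" for \<eta>
      proof -
        have "cis (x \<bullet> (\<eta> - \<xi>)) = cis (- (x \<bullet> \<xi>)) * cis (x \<bullet> \<eta>)"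
          by (simp add: cis_mult inner_diff_right)
        then show ?thesis by simp
      qed
      then have "(\<integral>\<eta>. ?F x \<eta> \<partial>lborel)
        = (cis (- (x \<bullet> \<xi>)) * ?G (e *\<^sub>R x)) * (\<integral>\<eta>. cis (x \<bullet> \<eta>) * h \<eta> \<partial>lborel)"
        by (simp only: integral_mult_right_zero)
      then show ?thesis by (simp add: inv_fourier_def)
    qed
    then show ?thesis by (simp only: integral_mult_right_zero)
  qed
  also have "(\<integral>x. (\<integral>\<eta>. ?F x \<eta> \<partial>lborel) \<partial>lborel) = (\<integral>\<eta>. (\<integral>x. ?F x \<eta> \<partial>lborel) \<partial>lborel)"
    by (rule lborel_pair.Fubini_integral[OF Fint, symmetric])
  also have "(\<lambda>\<eta>. \<integral>x. ?F x \<eta> \<partial>lborel)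
      = (\<lambda>\<eta>. complex_of_real (sqrt (2 * pi) ^ CARD('n) / e ^ CARD('n)) * (?G ((\<eta> - \<xi>) /\<^sub>R e) * h \<eta>))"
    by (rule ext) (simp only: integral_mult_left_zero inner, simp only: mult.assoc)
  also have "(\<integral>\<eta>. complex_of_real (sqrt (2 * pi) ^ CARD('n) / e ^ CARD('n)) * (?G ((\<eta> - \<xi>) /\<^sub>R e) * h \<eta>) \<partial>lborel)
      = complex_of_real (sqrt (2 * pi) ^ CARD('n) / e ^ CARD('n)) * (\<integral>\<eta>. ?G ((\<eta> - \<xi>) /\<^sub>R e) * h \<eta> \<partial>lborel)"
    by (simp only: integral_mult_right_zero)
  also have "(\<integral>\<eta>. ?G ((\<eta> - \<xi>) /\<^sub>R e) * h \<eta> \<partial>lborel)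
     = complex_of_real (e ^ CARD('n)) * (\<integral>v. ?G v * h (\<xi> + e *\<^sub>R v) \<partial>lborel)"
    using integral_lborel_affine[of e "\<lambda>\<eta>. ?G ((\<eta> - \<xi>) /\<^sub>R e) * h \<eta>" \<xi>] e
    by (simp add: scaleR_conv_of_real[where 'a = complex])
  finally show ?thesis using e by simp
qed

text \<open>Let the width of the Gaussian average tend to \<open>0\<close>.  This is how compact support on the
frequency side becomes known exactly.\<close>

theorem fourier_inv_fourier:
  fixes h :: "real^'n::finite \<Rightarrow> complex"
  assumes h: "test_function h"
  shows "fourier (inv_fourier h) \<xi> = h \<xi>"
proof -
  let ?e = "\<lambda>n. 1 / real (Suc n)"
  let ?G = "\<lambda>x::real^'n. complex_of_real (exp (- (norm x)\<^sup>2 / 2))"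
  let ?c = "complex_of_real (inv_const TYPE('n) * sqrt (2 * pi) ^ CARD('n))"
  have e: "?e \<longlonglongrightarrow> 0" by (rule LIMSEQ_Suc[OF lim_1_over_n])
  have Pint: "integrable lborel (inv_fourier h)" by (rule schwartz_integrable[OF schwartz_inv_fourier[OF h]])
  then have [measurable]: "inv_fourier h \<in> borel_measurable borel" by auto
  have [measurable]: "h \<in> borel_measurable borel" using test_function_integrable[OF h] by auto
  have Gint: "integrable lborel ?G" using integrable_gaussian_euclidean[of "0::real^'n"] by simp
  obtain B where B: "\<And>\<xi>. norm (h \<xi>) \<le> B" using test_function_bounded[OF h] by metis
  have L: "(\<lambda>n. \<integral>x. cis (- (x \<bullet> \<xi>)) * (?G (?e n *\<^sub>R x) * inv_fourier h x) \<partial>lborel)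
      \<longlonglongrightarrow> (\<integral>x. cis (- (x \<bullet> \<xi>)) * inv_fourier h x \<partial>lborel)"
  proof (rule integral_dominated_convergence[where w = "\<lambda>x. norm (inv_fourier h x)"])
    have "(\<lambda>n. cis (- (x \<bullet> \<xi>)) * (?G (?e n *\<^sub>R x) * inv_fourier h x))
        \<longlonglongrightarrow> cis (- (x \<bullet> \<xi>)) * (?G (0 *\<^sub>R x) * inv_fourier h x)" for x
      by (intro tendsto_intros e) simp
    then show "AE x in lborel. (\<lambda>n. cis (- (x \<bullet> \<xi>)) * (?G (?e n *\<^sub>R x) * inv_fourier h x))
        \<longlonglongrightarrow> cis (- (x \<bullet> \<xi>)) * inv_fourier h x" by simp
    show "AE x in lborel. norm (cis (- (x \<bullet> \<xi>)) * (?G (?e n *\<^sub>R x) * inv_fourier h x))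
        \<le> norm (inv_fourier h x)" for n
      by (intro AE_I2) (simp add: norm_mult mult_left_le_one_le)
  qed (use Pint in auto)
  have R: "(\<lambda>n. \<integral>v. ?G v * h (\<xi> + ?e n *\<^sub>R v) \<partial>lborel) \<longlonglongrightarrow> (\<integral>v. ?G v * h \<xi> \<partial>lborel)"
  proof (rule integral_dominated_convergence[where w = "\<lambda>v. norm (?G v) * B"])
    have "(\<lambda>n. h (\<xi> + ?e n *\<^sub>R v)) \<longlonglongrightarrow> h (\<xi> + 0 *\<^sub>R v)" for v
    proof (rule continuous_on_tendsto_compose[OF test_function_continuous[OF h]])
      show "(\<lambda>n. \<xi> + ?e n *\<^sub>R v) \<longlonglongrightarrow> \<xi> + 0 *\<^sub>R v" by (intro tendsto_intros e)
    qed auto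
    then show "AE v in lborel. (\<lambda>n. ?G v * h (\<xi> + ?e n *\<^sub>R v)) \<longlonglongrightarrow> ?G v * h \<xi>"
      by (intro AE_I2 tendsto_mult) auto
    show "integrable lborel (\<lambda>v. norm (?G v) * B)"
      using Gint by (intro integrable_mult_left integrable_norm)
    show "AE v in lborel. norm (?G v * h (\<xi> + ?e n *\<^sub>R v)) \<le> norm (?G v) * B" for n
      by (intro AE_I2) (simp add: norm_mult B)
  qed measurable
  have "(\<lambda>n. ?c * (\<integral>v. ?G v * h (\<xi> + ?e n *\<^sub>R v) \<partial>lborel)) \<longlonglongrightarrow> fourier (inv_fourier h) \<xi>"
    using L fourier_inv_fourier_regularized[OF h, of "?e _" \<xi>] by (simp add: fourier_def)
  moreover have "(\<lambda>n. ?c * (\<integral>v. ?G v * h (\<xi> + ?e n *\<^sub>R v) \<partial>lborel)) \<longlonglongrightarrow> ?c * (\<integral>v. ?G v * h \<xi> \<partial>lborel)"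
    by (intro tendsto_intros R)
  moreover have "?c * (\<integral>v. ?G v * h \<xi> \<partial>lborel) = h \<xi>"
  proof -
    have "(\<integral>v. ?G v \<partial>lborel) = complex_of_real (sqrt (2 * pi) ^ CARD('n))"
      using integral_gaussian_euclidean[of "0::real^'n"] by simp
    then have "(\<integral>v. ?G v * h \<xi> \<partial>lborel) = complex_of_real (sqrt (2 * pi) ^ CARD('n)) * h \<xi>"
      by (simp only: integral_mult_left_zero)
    moreover have "sqrt (2 * pi) ^ CARD('n) * sqrt (2 * pi) ^ CARD('n) = (2 * pi) ^ CARD('n)"
      unfolding power_mult_distrib[symmetric] by simp
    then have "inv_const TYPE('n) * sqrt (2 * pi) ^ CARD('n) * sqrt (2 * pi) ^ CARD('n) = 1"
      by (simp only: mult.assoc) simp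
    then have "?c * complex_of_real (sqrt (2 * pi) ^ CARD('n)) = 1"
      by (metis of_real_1 of_real_mult)
    ultimately show ?thesis by (simp only: mult.assoc[symmetric]) simp
  qed
  ultimately show ?thesis using LIMSEQ_unique by fastforce
qed

section \<open>Littlewood-Paley blocks as convolutions\<close>

text \<open>A Fourier multiplier is convolution with the inverse transform of its symbol; for an integrable symbol this is
Fubini's theorem alone.\<close>

lemma inv_fourier_mult_fourier:
  fixes m f :: "real^'n::finite \<Rightarrow> complex"
  assumes m: "integrable lborel m" and f: "integrable lborel f"
  shows "inv_fourier (\<lambda>\<xi>. m \<xi> * fourier f \<xi>) x = (\<integral>y. inv_fourier m (x - y) * f y \<partial>lborel)"
proof -
  let ?F = "\<lambda>y \<xi>. cis ((x - y) \<bullet> \<xi>) * m \<xi> * f y"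
  have [measurable]: "m \<in> borel_measurable borel" "f \<in> borel_measurable borel" using m f by auto
  have Fint: "integrable (lborel \<Otimes>\<^sub>M lborel) (case_prod ?F)"
    by (rule integrable_pair_product_bound[OF _ f m]) (simp_all add: norm_mult)
  have "cis (x \<bullet> \<xi>) * (m \<xi> * fourier f \<xi>) = (\<integral>y. ?F y \<xi> \<partial>lborel)" for \<xi>
  proof -
    have "?F y \<xi> = cis (x \<bullet> \<xi>) * m \<xi> * (cis (- (y \<bullet> \<xi>)) * f y)" for y
    proof -
      have "cis ((x - y) \<bullet> \<xi>) = cis (x \<bullet> \<xi>) * cis (- (y \<bullet> \<xi>))"
        by (simp add: cis_mult inner_diff_left)
      then show ?thesis by simp
    qed
    then have "(\<integral>y. ?F y \<xi> \<partial>lborel) = cis (x \<bullet> \<xi>) * m \<xi> * (\<integral>y. cis (- (y \<bullet> \<xi>)) * f y \<partial>lborel)"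
      by (simp only: integral_mult_right_zero)
    then show ?thesis by (simp only: fourier_def mult.assoc)
  qed
  then have "(\<integral>\<xi>. cis (x \<bullet> \<xi>) * (m \<xi> * fourier f \<xi>) \<partial>lborel) = (\<integral>\<xi>. (\<integral>y. ?F y \<xi> \<partial>lborel) \<partial>lborel)"
    by simp
  also have "\<dots> = (\<integral>y. (\<integral>\<xi>. ?F y \<xi> \<partial>lborel) \<partial>lborel)"
    by (rule lborel_pair.Fubini_integral[OF Fint])
  also have "\<dots> = (\<integral>y. (\<integral>\<xi>. cis ((x - y) \<bullet> \<xi>) * m \<xi> \<partial>lborel) * f y \<partial>lborel)"
    by (simp only: integral_mult_left_zero)
  finally show ?thesis
    unfolding inv_fourier_def by (simp only: integral_mult_right_zero mult.assoc)
qed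

lemma inv_fourier_scale:
  fixes h :: "real^'n::finite \<Rightarrow> complex"
  assumes "a > 0"
  shows "inv_fourier (\<lambda>\<xi>. h (\<xi> /\<^sub>R a)) z = complex_of_real (a ^ CARD('n)) * inv_fourier h (a *\<^sub>R z)"
  using integral_lborel_affine[of a "\<lambda>\<xi>. cis (z \<bullet> \<xi>) * h (\<xi> /\<^sub>R a)" 0] assms
  by (simp add: inv_fourier_def scaleR_conv_of_real[where 'a = complex] mult_ac)

lemma LP_cutoff_test_function:
  assumes "LP_cutoff \<phi>"
  shows "test_function (\<lambda>\<xi>. complex_of_real (\<phi> \<xi>))"
proof -
  obtain R where "\<And>\<xi>. \<phi> \<xi> \<noteq> 0 \<Longrightarrow> norm \<xi> \<le> R" using assms unfolding LP_cutoff_def by blast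
  then have "\<forall>\<xi>. norm \<xi> > R \<longrightarrow> complex_of_real (\<phi> \<xi>) = 0" by (auto simp: not_le[symmetric])
  moreover have "smooth (\<lambda>\<xi>. complex_of_real (\<phi> \<xi>))"
    using assms smooth_bounded_linear[OF bounded_linear_of_real] unfolding LP_cutoff_def by blast
  ultimately show ?thesis unfolding test_function_def by blast
qed

text \<open>The convolution kernel of the block \<open>j = 0\<close>.  The other kernels are its \<open>L^1\<close>-normalised dilates.\<close>

definition LP_kernel :: "(real^'n::finite \<Rightarrow> real) \<Rightarrow> real^'n \<Rightarrow> complex" where
  "LP_kernel \<phi> = inv_fourier (\<lambda>\<xi>. complex_of_real (\<phi> \<xi>))"

lemma schwartz_LP_kernel: "LP_cutoff \<phi> \<Longrightarrow> schwartz (LP_kernel \<phi>)"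
  unfolding LP_kernel_def by (intro schwartz_inv_fourier LP_cutoff_test_function)

lemma LP_proj_convolution:
  fixes \<phi> :: "real^'n::finite \<Rightarrow> real"
  assumes \<phi>: "LP_cutoff \<phi>" and f: "integrable lborel f"
  shows "LP_proj \<phi> j f x =
    (\<integral>y. complex_of_real ((2 powi j) ^ CARD('n)) * LP_kernel \<phi> ((2 powi j) *\<^sub>R (x - y)) * f y \<partial>lborel)"
proof -
  let ?a = "2 powi j :: real"
  have a: "?a > 0" by simp
  let ?m = "\<lambda>\<xi>. complex_of_real (\<phi> (\<xi> /\<^sub>R ?a))"
  have m: "integrable lborel ?m"
    using integrable_lborel_affine[OF test_function_integrable[OF LP_cutoff_test_function[OF \<phi>]], of "inverse ?a" 0] by simp
  have "LP_proj \<phi> j f x = inv_fourier (\<lambda>\<xi>. ?m \<xi> * fourier f \<xi>) x"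
    by (simp add: LP_proj_def power_int_minus)
  also have "\<dots> = (\<integral>y. inv_fourier ?m (x - y) * f y \<partial>lborel)"
    by (rule inv_fourier_mult_fourier[OF m f])
  finally show ?thesis
    by (simp only: inv_fourier_scale[OF a, of "\<lambda>\<xi>. complex_of_real (\<phi> \<xi>)"] LP_kernel_def)
qed

lemma Lp_norm_le:
  assumes "(\<integral>\<^sup>+x. ennreal (norm (f x) powr p) \<partial>lborel) \<le> ennreal (B powr p)" "p > 0" "B \<ge> 0"
  shows "Lp_norm p f \<le> ennreal B"
proof -
  let ?I = "\<integral>\<^sup>+x. ennreal (norm (f x) powr p) \<partial>lborel"
  have fin: "?I \<noteq> \<infinity>" using assms(1) by (auto simp: top_unique)
  have "enn2real ?I \<le> B powr p" using enn2real_mono[OF assms(1)] by simp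
  then have "enn2real ?I powr (1 / p) \<le> (B powr p) powr (1 / p)"
    using assms(2) by (intro powr_mono2) auto
  also have "\<dots> = B" using assms by (simp add: powr_powr)
  finally show ?thesis using fin by (simp add: Lp_norm_def Let_def ennreal_leI)
qed

lemma Lp_norm_zero: "Lp_norm p (\<lambda>x. 0) = 0"
  by (simp add: Lp_norm_def)

lemma Lp_norm_ge_on_ball:
  fixes f :: "real^'n::finite \<Rightarrow> complex"
  assumes f: "\<And>x. x \<in> ball 0 A \<Longrightarrow> c \<le> norm (f x)" and "c > 0" "p > 0"
  shows "ennreal (c * measure lborel (ball (0::real^'n) A) powr (1 / p)) \<le> Lp_norm p f"
proof -
  let ?I = "\<integral>\<^sup>+x. ennreal (norm (f x) powr p) \<partial>lborel"
  let ?B = "ball (0::real^'n) A"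
  show ?thesis
  proof (cases "?I = \<infinity>")
    case False
    have fin: "emeasure lborel ?B < \<infinity>" by (rule emeasure_bounded_finite) simp
    have "ennreal (c powr p * measure lborel ?B) = (\<integral>\<^sup>+x. ennreal (c powr p) * indicator ?B x \<partial>lborel)"
      using fin by (simp add: nn_integral_cmult_indicator emeasure_eq_ennreal_measure ennreal_mult less_top[symmetric])
    also have "\<dots> \<le> ?I"
      using f assms(2,3) by (intro nn_integral_mono) (auto simp: indicator_def intro!: ennreal_leI powr_mono2)
    finally have "c powr p * measure lborel ?B \<le> enn2real ?I"
      using False by (metis enn2real_ennreal enn2real_mono ennreal_leI infinity_ennreal_def less_top measure_nonneg
          mult_nonneg_nonneg powr_ge_zero)
    then have "(c powr p * measure lborel ?B) powr (1 / p) \<le> enn2real ?I powr (1 / p)"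
      using assms(3) by (intro powr_mono2) auto
    also have "(c powr p * measure lborel ?B) powr (1 / p) = c * measure lborel ?B powr (1 / p)"
      using assms(2,3) by (simp add: powr_mult powr_powr)
    finally show ?thesis using False by (simp add: Lp_norm_def Let_def ennreal_leI)
  qed (simp add: Lp_norm_def)
qed

text \<open>A convolution with an integrable kernel is bounded on \<open>L^1\<close> and on \<open>L^\<infinity>\<close>, and
\<open>|u|^p \<le> (sup |u|)^(p - 1) |u|\<close>; this is all that is needed for a function dominated by a fixed bounded
integrable \<open>W\<close>.  The factor \<open>t\<close> records the homogeneity of the estimate.\<close>

lemma Lp_norm_convolution_le:
  fixes k f :: "real^'n::finite \<Rightarrow> complex" and W :: "real^'n \<Rightarrow> real"
  assumes k: "integrable lborel k" and [measurable]: "f \<in> borel_measurable borel"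
    and W: "integrable lborel W" "\<And>x. W x \<le> M"
    and f: "\<And>x. norm (f x) \<le> t * W x" and t: "t > 0" and p: "p > 1"
  shows "Lp_norm p (\<lambda>x. \<integral>y. k (x - y) * f y \<partial>lborel)
    \<le> ennreal (t * ((\<integral>z. norm (k z) \<partial>lborel) powr p * M powr (p - 1) * (\<integral>y. W y \<partial>lborel)) powr (1 / p))"
proof (rule Lp_norm_le)
  let ?k1 = "\<integral>z. norm (k z) \<partial>lborel" and ?W1 = "\<integral>y. W y \<partial>lborel"
  let ?u = "\<lambda>x. \<integral>y. k (x - y) * f y \<partial>lborel"
  let ?C = "t * (?k1 powr p * M powr (p - 1) * ?W1) powr (1 / p)"
  have [measurable]: "k \<in> borel_measurable borel" "W \<in> borel_measurable borel" using k W by auto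
  have W0: "W x \<ge> 0" for x using order_trans[OF norm_ge_zero f[of x]] t by (simp add: zero_le_mult_iff)
  then have M0: "M \<ge> 0" using W(2) order_trans by blast
  have k1: "?k1 \<ge> 0" and W1: "?W1 \<ge> 0" using W0 by simp_all
  have kint: "integrable lborel (\<lambda>y. k (x - y))" for x
    using integrable_lborel_affine[OF k, of "-1" x] by simp
  have sup: "norm (?u x) \<le> ?k1 * (t * M)" for x
  proof -
    have fM: "norm (f y) \<le> t * M" for y using f[of y] W(2)[of y] t by (meson less_imp_le mult_left_mono order_trans)
    have "norm (?u x) \<le> (\<integral>y. norm (k (x - y) * f y) \<partial>lborel)" by (rule integral_norm_bound)
    also have "\<dots> \<le> (\<integral>y. norm (k (x - y)) * (t * M) \<partial>lborel)"
      by (rule integral_mono_AE') (use kint fM t M0 in \<open>auto simp: norm_mult mult_left_mono\<close>)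
    also have "\<dots> = ?k1 * (t * M)"
      using integral_lborel_reflect[of "\<lambda>z. norm (k z)" x] by (simp only: integral_mult_left_zero)
    finally show ?thesis .
  qed
  have L1: "(\<integral>\<^sup>+x. ennreal (norm (?u x)) \<partial>lborel) \<le> ennreal (?k1 * (t * ?W1))"
  proof -
    have "(\<integral>\<^sup>+x. ennreal (norm (?u x)) \<partial>lborel)
        \<le> (\<integral>\<^sup>+x. (\<integral>\<^sup>+y. ennreal (norm (k (x - y))) * ennreal (t * W y) \<partial>lborel) \<partial>lborel)"
    proof (rule nn_integral_mono)
      fix x
      have "ennreal (norm (?u x)) \<le> (\<integral>\<^sup>+y. ennreal (norm (k (x - y) * f y)) \<partial>lborel)"
        by (cases "integrable lborel (\<lambda>y. k (x - y) * f y)")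
           (simp_all add: integral_norm_bound_ennreal not_integrable_integral_eq)
      also have "\<dots> \<le> (\<integral>\<^sup>+y. ennreal (norm (k (x - y))) * ennreal (t * W y) \<partial>lborel)"
        using f by (intro nn_integral_mono) (simp add: norm_mult ennreal_mult' mult_left_mono ennreal_leI)
      finally show "ennreal (norm (?u x)) \<le> (\<integral>\<^sup>+y. ennreal (norm (k (x - y))) * ennreal (t * W y) \<partial>lborel)" .
    qed
    also have "\<dots> = (\<integral>\<^sup>+y. (\<integral>\<^sup>+x. ennreal (norm (k (x - y))) * ennreal (t * W y) \<partial>lborel) \<partial>lborel)"
      by (rule lborel_pair.Fubini') measurable
    also have "\<dots> = (\<integral>\<^sup>+y. ennreal ?k1 * ennreal (t * W y) \<partial>lborel)"
    proof -
      have "(\<integral>\<^sup>+x. ennreal (norm (k (x - y))) * ennreal (t * W y) \<partial>lborel) = ennreal ?k1 * ennreal (t * W y)" for y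
      proof -
        have "(\<integral>\<^sup>+x. ennreal (norm (k (x - y))) \<partial>lborel) = (\<integral>\<^sup>+x. ennreal (norm (k x)) \<partial>lborel)"
          using nn_integral_lborel_affine[of "\<lambda>x. ennreal (norm (k x))" 1 "- y"] by simp
        also have "\<dots> = ennreal ?k1" using k by (simp add: nn_integral_eq_integral)
        finally show ?thesis by (simp add: nn_integral_multc)
      qed
      then show ?thesis by simp
    qed
    also have "\<dots> = ennreal ?k1 * (\<integral>\<^sup>+y. ennreal (t * W y) \<partial>lborel)" by (rule nn_integral_cmult) simp
    also have "(\<integral>\<^sup>+y. ennreal (t * W y) \<partial>lborel) = ennreal (t * ?W1)"
      using W(1) W0 t by (subst nn_integral_eq_integral) auto
    finally show ?thesis using k1 by (simp add: ennreal_mult')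
  qed
  have "(\<integral>\<^sup>+x. ennreal (norm (?u x) powr p) \<partial>lborel)
      \<le> (\<integral>\<^sup>+x. ennreal ((?k1 * (t * M)) powr (p - 1)) * ennreal (norm (?u x)) \<partial>lborel)"
  proof (rule nn_integral_mono)
    fix x
    have "norm (?u x) powr p = norm (?u x) powr (p - 1) * norm (?u x)"
      using powr_add[of "norm (?u x)" "p - 1" 1] by simp
    also have "\<dots> \<le> (?k1 * (t * M)) powr (p - 1) * norm (?u x)"
      using sup[of x] p by (intro mult_right_mono powr_mono2) auto
    finally show "ennreal (norm (?u x) powr p) \<le> ennreal ((?k1 * (t * M)) powr (p - 1)) * ennreal (norm (?u x))"
      by (simp add: ennreal_mult'[symmetric] ennreal_leI)
  qed
  also have "\<dots> = ennreal ((?k1 * (t * M)) powr (p - 1)) * (\<integral>\<^sup>+x. ennreal (norm (?u x)) \<partial>lborel)"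
    by (rule nn_integral_cmult) measurable
  also have "\<dots> \<le> ennreal ((?k1 * (t * M)) powr (p - 1)) * ennreal (?k1 * (t * ?W1))"
    by (rule mult_left_mono[OF L1]) simp
  also have "\<dots> = ennreal ((?k1 * (t * M)) powr (p - 1) * (?k1 * (t * ?W1)))"
    by (simp add: ennreal_mult')
  also have "(?k1 * (t * M)) powr (p - 1) * (?k1 * (t * ?W1)) = ?C powr p"
  proof -
    have "x powr (p - 1) * x = x powr p" if "x \<ge> 0" for x :: real
      using powr_add[of x "p - 1" 1] that by simp
    from this[of ?k1] this[of t] k1 t
    have "(?k1 * (t * M)) powr (p - 1) * (?k1 * (t * ?W1)) = t powr p * (?k1 powr p * M powr (p - 1) * ?W1)"
      using M0 by (simp add: powr_mult mult_ac)
    also have "\<dots> = ?C powr p"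
      using p t W1 by (simp add: powr_mult powr_powr)
    finally show ?thesis .
  qed
  finally show "(\<integral>\<^sup>+x. ennreal (norm (?u x) powr p) \<partial>lborel) \<le> ennreal (?C powr p)" .
  show "p > 0" "?C \<ge> 0" using p t by auto
qed

text \<open>The bound is uniform in \<open>j\<close> because dilating the kernel keeps its \<open>L^1\<close> norm.\<close>

lemma Lp_norm_LP_proj_le:
  fixes \<phi> W :: "real^'n::finite \<Rightarrow> real"
  assumes \<phi>: "LP_cutoff \<phi>" and p: "p > 1" and W: "integrable lborel W" "\<And>x. W x \<le> M"
  obtains C where "C \<ge> 0" "\<And>j t f. t > 0 \<Longrightarrow> f \<in> borel_measurable borel \<Longrightarrow> (\<And>x. norm (f x) \<le> t * W x)
    \<Longrightarrow> Lp_norm p (LP_proj \<phi> j f) \<le> ennreal (t * C)"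
proof
  let ?K1 = "\<integral>z. norm (LP_kernel \<phi> z) \<partial>lborel"
  let ?C = "(?K1 powr p * M powr (p - 1) * (\<integral>y. W y \<partial>lborel)) powr (1 / p)"
  show "?C \<ge> 0" by simp
  fix j t and f :: "real^'n \<Rightarrow> complex"
  assume t: "t > 0" and f: "f \<in> borel_measurable borel" "\<And>x. norm (f x) \<le> t * W x"
  let ?a = "2 powi j :: real"
  define k where "k z = complex_of_real (?a ^ CARD('n)) * LP_kernel \<phi> (?a *\<^sub>R z)" for z
  have Kint: "integrable lborel (LP_kernel \<phi>)" by (rule schwartz_integrable[OF schwartz_LP_kernel[OF \<phi>]])
  have k: "integrable lborel k"
    unfolding k_def using integrable_lborel_affine[OF Kint, of ?a 0] by simp
  have k1: "(\<integral>z. norm (k z) \<partial>lborel) = ?K1"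
    using integral_lborel_affine[of ?a "\<lambda>z. norm (LP_kernel \<phi> z)" 0] by (simp add: k_def norm_mult norm_power norm_power_int)
  have fint: "integrable lborel f"
  proof (rule Bochner_Integration.integrable_bound)
    show "integrable lborel (\<lambda>x. t * W x)" using W(1) by simp
    show "AE x in lborel. norm (f x) \<le> norm (t * W x)"
      using f(2) by (intro AE_I2) (smt (verit) real_norm_def)
  qed (use f(1) in simp)
  have "LP_proj \<phi> j f = (\<lambda>x. \<integral>y. k (x - y) * f y \<partial>lborel)"
    by (rule ext) (simp only: LP_proj_convolution[OF \<phi> fint] k_def)
  then show "Lp_norm p (LP_proj \<phi> j f) \<le> ennreal (t * ?C)"
    using Lp_norm_convolution_le[OF k f(1) W f(2) t p] by (simp add: k1)
qed

section \<open>A lower bound for low-frequency blocks\<close>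

text \<open>A continuous function that is positive somewhere is positive on an open set, and open sets are not negligible.\<close>

lemma integral_continuous_pos:
  fixes f :: "'a::euclidean_space \<Rightarrow> real"
  assumes cont: "continuous_on UNIV f" and int: "integrable lborel f"
    and nonneg: "\<And>x. f x \<ge> 0" and pos: "f x0 > 0"
  shows "(\<integral>x. f x \<partial>lborel) > 0"
proof (rule ccontr)
  assume "\<not> ?thesis"
  moreover have "(\<integral>x. f x \<partial>lborel) \<ge> 0" using nonneg by simp
  ultimately have "(\<integral>x. f x \<partial>lborel) = 0" by simp
  then have "AE x in lborel. f x = 0"
    using integral_nonneg_eq_0_iff_AE[OF int] nonneg by simp
  moreover have meas: "{x. f x > 0} \<in> sets lborel" and op: "open {x. f x > 0}"
    using open_Collect_less[OF continuous_on_const cont] by auto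
  ultimately have "emeasure lborel {x. f x > 0} = 0"
    using nonneg by (subst AE_iff_measurable[OF meas, symmetric]) (auto simp: less_le[of 0])
  then have "{x. f x > 0} \<in> null_sets lebesgue" using meas by (intro null_sets_completionI) auto
  then have "negligible {x. f x > 0}" by (simp add: negligible_iff_null_sets)
  moreover have "{x. f x > 0} \<noteq> {}" using pos by auto
  ultimately show False using open_not_negligible[OF op] by simp
qed

lemma LP_cutoff_nonzero:
  assumes "LP_cutoff \<phi>"
  obtains \<xi> where "\<phi> \<xi> > 0"
proof -
  have "\<exists>\<xi>. \<phi> \<xi> \<noteq> 0"
  proof (rule ccontr)
    assume "\<nexists>\<xi>. \<phi> \<xi> \<noteq> 0"
    moreover have "((\<lambda>j::int. \<phi> (2 powi (- j) *\<^sub>R axis k 1)) has_sum 1) UNIV" for k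
      using assms unfolding LP_cutoff_def by (metis axis_eq_0_iff zero_neq_one)
    ultimately have "((\<lambda>j::int. 0::real) has_sum 1) UNIV" by simp
    then show False using has_sum_unique[OF has_sum_0] by (metis zero_neq_one)
  qed
  moreover have "\<phi> \<xi> \<ge> 0" for \<xi> using assms unfolding LP_cutoff_def by blast
  ultimately show ?thesis using that by (metis less_le)
qed

text \<open>The kernel at the origin is, up to a positive constant, the integral of the cutoff.\<close>

lemma LP_kernel_0_pos:
  fixes \<phi> :: "real^'n::finite \<Rightarrow> real"
  assumes \<phi>: "LP_cutoff \<phi>"
  shows "Re (LP_kernel \<phi> 0) > 0"
proof -
  obtain \<xi> where \<xi>: "\<phi> \<xi> > 0" using LP_cutoff_nonzero[OF \<phi>] by blast
  have nonneg: "\<phi> \<xi> \<ge> 0" for \<xi> using \<phi> unfolding LP_cutoff_def by blast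
  have cont: "continuous_on UNIV \<phi>" using \<phi> unfolding LP_cutoff_def by (blast intro: smooth_continuous)
  have int: "integrable lborel \<phi>"
    using integrable_Re[OF test_function_integrable[OF LP_cutoff_test_function[OF \<phi>]]] by simp
  have "(\<integral>\<xi>. \<phi> \<xi> \<partial>lborel) > 0" by (rule integral_continuous_pos[OF cont int nonneg \<xi>])
  then show ?thesis by (simp add: LP_kernel_def inv_fourier_def)
qed

text \<open>A sufficiently low block detects the mass of a nonnegative function.  The real part of the kernel is at least a
constant \<open>\<kappa> > 0\<close> near \<open>0\<close>; for very negative \<open>j\<close> the dilated kernel is therefore positive on a ball that carries
all but a small part of the mass of \<open>W\<close>, and the convolution cannot cancel on that ball.  The block and the constants depend on \<open>w\<close>
only through \<open>W\<close> and \<open>m\<close>; an \<open>L^1\<close> perturbation \<open>u\<close> of \<open>w\<close> is harmless since the kernel is bounded.\<close>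

lemma Lp_norm_LP_proj_ge:
  fixes \<phi> W :: "real^'n::finite \<Rightarrow> real"
  assumes \<phi>: "LP_cutoff \<phi>" and p: "p > 0" and W: "integrable lborel W" and m: "m > 0"
  obtains j c \<epsilon> where "c > 0" "\<epsilon> > 0"
    "\<forall>u w t. integrable lborel u \<and> integrable lborel w \<and> (\<forall>x. 0 \<le> w x \<and> w x \<le> W x) \<and>
      m \<le> (\<integral>x. w x \<partial>lborel) \<and> (\<integral>x. \<bar>u x - w x\<bar> \<partial>lborel) \<le> \<epsilon> \<and> t > 0 \<longrightarrow>
      ennreal (t * c) \<le> Lp_norm p (LP_proj \<phi> j (\<lambda>x. complex_of_real (t * u x)))"
proof -
  define K where "K z = Re (LP_kernel \<phi> z)" for z
  define \<kappa> where "\<kappa> = K 0 / 2"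
  have \<kappa>: "\<kappa> > 0" using LP_kernel_0_pos[OF \<phi>] by (simp add: \<kappa>_def K_def)
  have contK: "continuous_on UNIV (LP_kernel \<phi>)"
    using schwartz_LP_kernel[OF \<phi>] smooth_continuous unfolding schwartz_def by blast
  then have "continuous_on UNIV K" unfolding K_def by (intro continuous_intros)
  then obtain \<delta> where \<delta>: "\<delta> > 0" "\<And>z. norm z < \<delta> \<Longrightarrow> \<bar>K z - K 0\<bar> < \<kappa>"
    using \<kappa> unfolding continuous_on_iff dist_norm by (metis UNIV_I diff_zero real_norm_def)
  have Klow: "K z \<ge> \<kappa>" if "norm z < \<delta>" for z using \<delta>(2)[OF that] unfolding \<kappa>_def by linarith
  obtain L where L: "\<And>z. norm (LP_kernel \<phi> z) \<le> L" "L > 0"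
  proof
    let ?L = "inv_const TYPE('n) * (\<integral>\<xi>. norm (complex_of_real (\<phi> \<xi>)) \<partial>lborel)"
    show "norm (LP_kernel \<phi> z) \<le> \<bar>?L\<bar> + 1" for z
      using norm_inv_fourier_le[of "\<lambda>\<xi>. complex_of_real (\<phi> \<xi>)" z] unfolding LP_kernel_def by linarith
    show "\<bar>?L\<bar> + 1 > 0" by linarith
  qed
  have KL: "\<bar>K z\<bar> \<le> L" for z using L(1)[of z] abs_Re_le_cmod[of "LP_kernel \<phi> z"] by (simp add: K_def)
  have [measurable]: "W \<in> borel_measurable borel" using W by auto
  have "(\<lambda>n. \<integral>y. indicator (- ball 0 (real n)) y * W y \<partial>lborel) \<longlonglongrightarrow> (\<integral>y. 0 \<partial>(lborel :: (real^'n) measure))"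
  proof (rule integral_dominated_convergence[where w = "\<lambda>y. norm (W y)"])
    have "(\<lambda>n. indicator (- ball 0 (real n)) y * W y) \<longlonglongrightarrow> 0" for y :: "real^'n"
    proof (rule tendsto_eventually)
      obtain n0 where "norm y < real n0" using reals_Archimedean2 by blast
      then show "\<forall>\<^sub>F n in sequentially. indicator (- ball 0 (real n)) y * W y = 0"
        by (intro eventually_sequentiallyI[of n0]) (auto simp: indicator_def)
    qed
    then show "AE y::real^'n in lborel. (\<lambda>n. indicator (- ball 0 (real n)) y * W y) \<longlonglongrightarrow> 0" by simp
  qed (use W in \<open>auto simp: indicator_def\<close>)
  then have "(\<lambda>n. \<integral>y. indicator (- ball 0 (real n)) y * W y \<partial>lborel) \<longlonglongrightarrow> 0" by simp
  moreover have \<tau>pos: "\<kappa> * m / (4 * (\<kappa> + L)) > 0" using \<kappa> L(2) m by simp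
  ultimately have "\<forall>\<^sub>F n in sequentially. (\<integral>y. indicator (- ball 0 (real n)) y * W y \<partial>lborel) < \<kappa> * m / (4 * (\<kappa> + L))"
    by (rule order_tendstoD)
  then obtain n0 where "\<And>n. n \<ge> n0 \<Longrightarrow> (\<integral>y. indicator (- ball 0 (real n)) y * W y \<partial>lborel) < \<kappa> * m / (4 * (\<kappa> + L))"
    unfolding eventually_sequentially by blast
  then obtain n :: nat where n: "n > 0" "(\<integral>y. indicator (- ball 0 (real n)) y * W y \<partial>lborel) < \<kappa> * m / (4 * (\<kappa> + L))"
    by (meson le_SucI le_refl zero_less_Suc)
  define A where "A = real n"
  have A: "A > 0" using n by (simp add: A_def)
  obtain i where i: "(1 / 2) ^ i < \<delta> / (2 * A)"
    using real_arch_pow_inv[of "\<delta> / (2 * A)" "1 / 2"] \<delta>(1) A by auto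
  define j where "j = - int i"
  define a where "a = (2 powi j :: real)"
  have a: "a > 0" "a * (2 * A) < \<delta>"
    using i A by (auto simp: a_def j_def power_int_minus field_simps power_one_over)
  define d where "d = a ^ CARD('n)"
  have d: "d > 0" using a by (simp add: d_def)
  \<comment> \<open>Budget for the convolution on the ball, up to the factor \<open>d\<close>: the mass contributes \<open>\<kappa> m\<close>; the part of \<open>W\<close> outside the ball and the perturbation cost at most \<open>\<kappa> m / 4\<close> each.\<close>
  define \<epsilon> where "\<epsilon> = \<kappa> * m / (4 * L)"
  define c0 where "c0 = d * (\<kappa> * m / 2)"
  have c0: "c0 > 0" using d \<kappa> m by (simp add: c0_def)
  define c where "c = c0 * measure lborel (ball (0::real^'n) A) powr (1 / p)"
  show ?thesis
  proof (rule that[of c \<epsilon> j])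
    have "measure lborel (ball (0::real^'n) A) > 0"
      using content_ball_pos[OF A] by simp
    then show "c > 0" using c0 by (simp add: c_def)
    show "\<epsilon> > 0" using \<kappa> m L by (simp add: \<epsilon>_def)
    have "ennreal (t * c) \<le> Lp_norm p (LP_proj \<phi> j (\<lambda>x. complex_of_real (t * u x)))"
      if u: "integrable lborel u" and w: "integrable lborel w" "\<And>x. 0 \<le> w x \<and> w x \<le> W x"
        "m \<le> (\<integral>x. w x \<partial>lborel)" "(\<integral>x. \<bar>u x - w x\<bar> \<partial>lborel) \<le> \<epsilon>" and t: "t > 0"
      for u w :: "real^'n \<Rightarrow> real" and t :: real
    proof -
      have [measurable]: "u \<in> borel_measurable borel" "w \<in> borel_measurable borel" "LP_kernel \<phi> \<in> borel_measurable borel"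
        using u w(1) contK by (auto intro: borel_measurable_continuous_onI)
      have low: "t * c0 \<le> norm (LP_proj \<phi> j (\<lambda>x. complex_of_real (t * u x)) x)" if x: "x \<in> ball 0 A" for x
      proof -
        have Kuint: "integrable lborel (\<lambda>y. K (a *\<^sub>R (x - y)) * v y)" if v: "integrable lborel v" for v :: "real^'n \<Rightarrow> real"
        proof (rule Bochner_Integration.integrable_bound)
          show "integrable lborel (\<lambda>y. L * v y)" using v by simp
          have [measurable]: "v \<in> borel_measurable borel" using v by auto
          show "(\<lambda>y. K (a *\<^sub>R (x - y)) * v y) \<in> borel_measurable lborel" unfolding K_def by measurable
          show "AE y in lborel. norm (K (a *\<^sub>R (x - y)) * v y) \<le> norm (L * v y)"
            using KL L(2) by (simp add: abs_mult mult_right_mono)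
        qed
        have intc: "integrable lborel (\<lambda>y. complex_of_real d * LP_kernel \<phi> (a *\<^sub>R (x - y)) * complex_of_real (t * u y))"
        proof (rule Bochner_Integration.integrable_bound)
          show "integrable lborel (\<lambda>y. d * L * (t * u y))" using u by simp
          show "AE y in lborel. norm (complex_of_real d * LP_kernel \<phi> (a *\<^sub>R (x - y)) * complex_of_real (t * u y)) \<le> norm (d * L * (t * u y))"
            using L d t by (auto simp: norm_mult abs_mult intro!: mult_right_mono)
        qed measurable
        \<comment> \<open>Inside the ball the kernel is at least \<open>\<kappa>\<close>; outside it is at least \<open>- L\<close>, which the second term compensates.\<close>
        have "(\<integral>y. \<kappa> * w y - (\<kappa> + L) * (indicator (- ball 0 A) y * W y) \<partial>lborel) \<le> (\<integral>y. K (a *\<^sub>R (x - y)) * w y \<partial>lborel)"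
        proof (rule integral_mono)
          have "integrable lborel (\<lambda>y. indicator (- ball 0 A) y * W y)"
            by (rule Bochner_Integration.integrable_bound[OF W]) (auto simp: indicator_def)
          then show "integrable lborel (\<lambda>y. \<kappa> * w y - (\<kappa> + L) * (indicator (- ball 0 A) y * W y))"
            using w(1) by simp
          show "integrable lborel (\<lambda>y. K (a *\<^sub>R (x - y)) * w y)" by (rule Kuint[OF w(1)])
          fix y
          show "\<kappa> * w y - (\<kappa> + L) * (indicator (- ball 0 A) y * W y) \<le> K (a *\<^sub>R (x - y)) * w y"
          proof (cases "y \<in> ball 0 A")
            case True
            then have "norm (x - y) \<le> 2 * A" using x norm_triangle_ineq4[of x y] by simp
            then have "a * norm (x - y) \<le> a * (2 * A)" using a(1) by (intro mult_left_mono) auto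
            from le_less_trans[OF this a(2)] have "norm (a *\<^sub>R (x - y)) < \<delta>" using a(1) by simp
            then have "\<kappa> * w y \<le> K (a *\<^sub>R (x - y)) * w y" using Klow w(2) by (intro mult_right_mono) auto
            then show ?thesis using True by simp
          next
            case False
            have "- L * w y \<le> K (a *\<^sub>R (x - y)) * w y" using KL[of "a *\<^sub>R (x - y)"] w(2)[of y]
              by (intro mult_right_mono) auto
            moreover have "(\<kappa> + L) * w y \<le> (\<kappa> + L) * W y" using w(2)[of y] \<kappa> L(2) by (intro mult_left_mono) auto
            ultimately show ?thesis using False by (simp add: algebra_simps)
          qed
        qed
        also have "(\<integral>y. \<kappa> * w y - (\<kappa> + L) * (indicator (- ball 0 A) y * W y) \<partial>lborel)
            = \<kappa> * (\<integral>y. w y \<partial>lborel) - (\<kappa> + L) * (\<integral>y. indicator (- ball 0 A) y * W y \<partial>lborel)"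
        proof (subst Bochner_Integration.integral_diff)
          show "integrable lborel (\<lambda>y. (\<kappa> + L) * (indicator (- ball 0 A) y * W y))"
            by (intro integrable_mult_right Bochner_Integration.integrable_bound[OF W]) (auto simp: indicator_def)
        qed (use w(1) in auto)
        finally have "\<kappa> * m - \<kappa> * m / 4 \<le> (\<integral>y. K (a *\<^sub>R (x - y)) * w y \<partial>lborel)"
        proof -
          assume "\<kappa> * (\<integral>y. w y \<partial>lborel) - (\<kappa> + L) * (\<integral>y. indicator (- ball 0 A) y * W y \<partial>lborel)
            \<le> (\<integral>y. K (a *\<^sub>R (x - y)) * w y \<partial>lborel)"
          moreover have "\<kappa> * m \<le> \<kappa> * (\<integral>y. w y \<partial>lborel)" using w(3) \<kappa> by simp
          moreover have "(\<kappa> + L) * (\<integral>y. indicator (- ball 0 A) y * W y \<partial>lborel) \<le> (\<kappa> + L) * (\<kappa> * m / (4 * (\<kappa> + L)))"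
            using n(2) \<kappa> L(2) by (intro mult_left_mono) (auto simp: A_def)
          moreover have "(\<kappa> + L) * (\<kappa> * m / (4 * (\<kappa> + L))) = \<kappa> * m / 4" using \<kappa> L(2) by (simp add: field_simps)
          ultimately show ?thesis by linarith
        qed
        moreover have "\<bar>\<integral>y. K (a *\<^sub>R (x - y)) * (u y - w y) \<partial>lborel\<bar> \<le> \<kappa> * m / 4"
        proof -
          have "\<bar>\<integral>y. K (a *\<^sub>R (x - y)) * (u y - w y) \<partial>lborel\<bar> \<le> (\<integral>y. \<bar>K (a *\<^sub>R (x - y)) * (u y - w y)\<bar> \<partial>lborel)"
            by (rule integral_abs_bound)
          also have "\<dots> \<le> (\<integral>y. L * \<bar>u y - w y\<bar> \<partial>lborel)"
            by (rule integral_mono_AE') (use u w(1) KL L(2) in \<open>auto simp: abs_mult mult_right_mono\<close>)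
          also have "\<dots> \<le> L * \<epsilon>" using w(4) L(2) by simp
          finally show ?thesis using L(2) by (simp add: \<epsilon>_def)
        qed
        moreover have "(\<integral>y. K (a *\<^sub>R (x - y)) * u y \<partial>lborel)
           = (\<integral>y. K (a *\<^sub>R (x - y)) * w y \<partial>lborel) + (\<integral>y. K (a *\<^sub>R (x - y)) * (u y - w y) \<partial>lborel)"
          using Kuint[OF u] Kuint[OF w(1)] by (simp add: right_diff_distrib)
        ultimately have "\<kappa> * m / 2 \<le> (\<integral>y. K (a *\<^sub>R (x - y)) * u y \<partial>lborel)" by linarith
        then have "t * c0 \<le> t * d * (\<integral>y. K (a *\<^sub>R (x - y)) * u y \<partial>lborel)"
          using t d by (simp add: c0_def mult.assoc mult_left_mono)
        also have "\<dots> = (\<integral>y. t * d * (K (a *\<^sub>R (x - y)) * u y) \<partial>lborel)" by simp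
        also have "\<dots> = (\<integral>y. Re (complex_of_real d * LP_kernel \<phi> (a *\<^sub>R (x - y)) * complex_of_real (t * u y)) \<partial>lborel)"
          by (rule Bochner_Integration.integral_cong) (simp_all add: K_def mult_ac)
        also have "\<dots> = Re (\<integral>y. complex_of_real d * LP_kernel \<phi> (a *\<^sub>R (x - y)) * complex_of_real (t * u y) \<partial>lborel)"
          by (rule integral_Re[OF intc])
        also have "\<dots> = Re (LP_proj \<phi> j (\<lambda>x. complex_of_real (t * u x)) x)"
          using u by (subst LP_proj_convolution[OF \<phi>]) (simp_all only: a_def d_def, auto)
        also have "\<dots> \<le> norm (LP_proj \<phi> j (\<lambda>x. complex_of_real (t * u x)) x)" by (rule complex_Re_le_cmod)
        finally show ?thesis .
      qed
      have "ennreal (t * c0 * measure lborel (ball (0::real^'n) A) powr (1 / p))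
        \<le> Lp_norm p (LP_proj \<phi> j (\<lambda>x. complex_of_real (t * u x)))"
        by (rule Lp_norm_ge_on_ball[OF low]) (use t c0 p in auto)
      then show ?thesis
        by (simp add: c_def mult.assoc)
    qed
    then show "\<forall>u w t. integrable lborel u \<and> integrable lborel w \<and> (\<forall>x. 0 \<le> w x \<and> w x \<le> W x) \<and>
      m \<le> (\<integral>x. w x \<partial>lborel) \<and> (\<integral>x. \<bar>u x - w x\<bar> \<partial>lborel) \<le> \<epsilon> \<and> t > 0 \<longrightarrow>
      ennreal (t * c) \<le> Lp_norm p (LP_proj \<phi> j (\<lambda>x. complex_of_real (t * u x)))" by blast
  qed
qed

section \<open>Besov norms of spectrally localized functions\<close>

lemma besov_norm_ge_block:
  "ennreal (2 powr (of_int j * \<gamma>)) * Lp_norm p (LP_proj \<phi> j (\<lambda>x. complex_of_real (f x))) \<le> besov_norm \<phi> \<gamma> p f"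
proof -
  let ?b = "\<lambda>j::int. ennreal (2 powr (of_int j * \<gamma>)) * Lp_norm p (LP_proj \<phi> j (\<lambda>x. complex_of_real (f x)))"
  have "infsum ?b {j} \<le> infsum ?b UNIV"
    by (rule infsum_mono_neutral) (auto intro: nonneg_summable_on_complete)
  then show ?thesis by (simp add: besov_norm_def)
qed

lemma besov_norm_zero: "besov_norm \<phi> \<gamma> p (\<lambda>x. 0) = 0"
proof -
  have "LP_proj \<phi> j (\<lambda>x. 0) = (\<lambda>x. 0)" for j
    by (rule ext) (simp add: LP_proj_def fourier_def inv_fourier_def)
  then show ?thesis by (simp add: besov_norm_def Lp_norm_zero)
qed

text \<open>For a function with spectrum in a dyadic annulus of size \<open>2^N\<close>, only the blocks with \<open>|j - N| \<le> m\<close> are nonzero,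
where \<open>m\<close> depends on the support of the cutoff; the weights of these blocks are comparable with \<open>2^(N \<gamma>)\<close>.\<close>

lemma besov_norm_localized_le:
  fixes \<phi> W :: "real^'n::finite \<Rightarrow> real"
  assumes \<phi>: "LP_cutoff \<phi>" and p: "p > 1" and W: "integrable lborel W" "\<And>x. W x \<le> M"
  obtains C where "C \<ge> 0" "\<And>N t f. t > 0 \<Longrightarrow> f \<in> borel_measurable borel \<Longrightarrow> (\<And>x. \<bar>f x\<bar> \<le> t * W x) \<Longrightarrow>
    (\<And>\<xi>. fourier (\<lambda>x. complex_of_real (f x)) \<xi> \<noteq> 0 \<Longrightarrow>
      2 powr (real_of_int N - 1) \<le> norm \<xi> \<and> norm \<xi> \<le> 2 powr (real_of_int N + 1)) \<Longrightarrow>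
    besov_norm \<phi> \<gamma> p f \<le> ennreal (C * t * 2 powr (of_int N * \<gamma>))"
proof -
  obtain r R where rR: "0 < r" "r < R" "\<And>\<xi>. \<phi> \<xi> \<noteq> 0 \<Longrightarrow> r \<le> norm \<xi> \<and> norm \<xi> \<le> R"
    using \<phi> unfolding LP_cutoff_def by blast
  obtain D where D: "D \<ge> 0" "\<And>j t f. t > 0 \<Longrightarrow> f \<in> borel_measurable borel \<Longrightarrow> (\<And>x. norm (f x) \<le> t * W x)
    \<Longrightarrow> Lp_norm p (LP_proj \<phi> j f) \<le> ennreal (t * D)"
    using Lp_norm_LP_proj_le[OF \<phi> p W] by metis
  obtain m where m: "max (2 * R) (2 / r) < 2 ^ m"
    using real_arch_pow[of 2 "max (2 * R) (2 / r)"] by auto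
  define C where "C = real (2 * m + 1) * (2 powr (real m * \<bar>\<gamma>\<bar>) * D)"
  show ?thesis
  proof (rule that[of C])
    show "C \<ge> 0" using D(1) by (simp add: C_def)
    fix N t and f :: "real^'n \<Rightarrow> real"
    assume t: "t > 0" and f: "f \<in> borel_measurable borel" "\<And>x. \<bar>f x\<bar> \<le> t * W x"
      and supp: "\<And>\<xi>. fourier (\<lambda>x. complex_of_real (f x)) \<xi> \<noteq> 0 \<Longrightarrow>
        2 powr (real_of_int N - 1) \<le> norm \<xi> \<and> norm \<xi> \<le> 2 powr (real_of_int N + 1)"
    let ?f = "\<lambda>x. complex_of_real (f x)"
    let ?J = "{N - int m..N + int m}"
    \<comment> \<open>The annulus of the spectrum and that of the dilated cutoff are disjoint.\<close>
    have vanish: "LP_proj \<phi> j ?f = (\<lambda>x. 0)" if j: "j \<notin> ?J" for j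
    proof -
      have "complex_of_real (\<phi> (2 powi (- j) *\<^sub>R \<xi>)) * fourier ?f \<xi> = 0" for \<xi>
      proof (rule ccontr)
        assume "complex_of_real (\<phi> (2 powi (- j) *\<^sub>R \<xi>)) * fourier ?f \<xi> \<noteq> 0"
        then have nz: "\<phi> (2 powi (- j) *\<^sub>R \<xi>) \<noteq> 0" "fourier ?f \<xi> \<noteq> 0" by auto
        have pw: "2 powi (- j) = 2 powr - real_of_int j" by (simp add: powr_real_of_int' flip: of_int_minus)
        have 1: "r \<le> 2 powr - real_of_int j * norm \<xi>" "2 powr - real_of_int j * norm \<xi> \<le> R"
          using rR(3)[OF nz(1)] by (auto simp: pw)
        have 2: "2 powr (real_of_int N - 1) \<le> norm \<xi>" "norm \<xi> \<le> 2 powr (real_of_int N + 1)"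
          using supp[OF nz(2)] by auto
        have m': "2 powr real m = 2 ^ m" by (simp add: powr_realpow)
        have "2 powr (real_of_int N - 1 - real_of_int j) = 2 powr - real_of_int j * 2 powr (real_of_int N - 1)"
          by (simp flip: powr_add)
        also have "\<dots> \<le> 2 powr - real_of_int j * norm \<xi>" using 2(1) by (simp add: mult_left_mono)
        also have "\<dots> \<le> R" by (rule 1(2))
        also have "\<dots> < 2 powr (real m - 1)" using m by (simp add: powr_diff m')
        finally have a: "real_of_int N - 1 - real_of_int j < real m - 1" by simp
        have "2 powr (1 - real m) = 2 / 2 ^ m" by (simp add: powr_diff m')
        also have "\<dots> < r" using m rR(1) by (simp add: field_simps)
        also have "\<dots> \<le> 2 powr - real_of_int j * norm \<xi>" by (rule 1(1))
        also have "\<dots> \<le> 2 powr - real_of_int j * 2 powr (real_of_int N + 1)" using 2(2) by (simp add: mult_left_mono)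
        also have "\<dots> = 2 powr (real_of_int N + 1 - real_of_int j)" by (simp flip: powr_add)
        finally have b: "1 - real m < real_of_int N + 1 - real_of_int j" by simp
        show False using a b j by simp
      qed
      then have zero: "(\<lambda>\<xi>. complex_of_real (\<phi> (2 powi (- j) *\<^sub>R \<xi>)) * fourier ?f \<xi>) = (\<lambda>\<xi>. 0)"
        by (rule ext)
      show ?thesis unfolding LP_proj_def zero by (rule ext) (simp add: inv_fourier_def)
    qed
    have block: "ennreal (2 powr (of_int j * \<gamma>)) * Lp_norm p (LP_proj \<phi> j ?f)
      \<le> ennreal (2 powr (real m * \<bar>\<gamma>\<bar>) * D * t * 2 powr (of_int N * \<gamma>))" if j: "j \<in> ?J" for j
    proof -
      have "(of_int j - of_int N) * \<gamma> \<le> \<bar>real_of_int j - of_int N\<bar> * \<bar>\<gamma>\<bar>"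
        by (metis abs_ge_self abs_mult)
      also have "\<dots> \<le> real m * \<bar>\<gamma>\<bar>" using j by (intro mult_right_mono) auto
      finally have "of_int j * \<gamma> \<le> real m * \<bar>\<gamma>\<bar> + of_int N * \<gamma>" by (simp add: algebra_simps)
      then have "2 powr (of_int j * \<gamma>) \<le> 2 powr (real m * \<bar>\<gamma>\<bar>) * 2 powr (of_int N * \<gamma>)"
        by (simp flip: powr_add)
      moreover have "Lp_norm p (LP_proj \<phi> j ?f) \<le> ennreal (t * D)"
        using f by (intro D(2) t) auto
      ultimately have "ennreal (2 powr (of_int j * \<gamma>)) * Lp_norm p (LP_proj \<phi> j ?f)
        \<le> ennreal (2 powr (real m * \<bar>\<gamma>\<bar>) * 2 powr (of_int N * \<gamma>)) * ennreal (t * D)"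
        by (intro mult_mono ennreal_leI) auto
      also have "\<dots> = ennreal (2 powr (real m * \<bar>\<gamma>\<bar>) * D * t * 2 powr (of_int N * \<gamma>))"
        by (subst ennreal_mult'[symmetric]) (simp_all add: mult_ac)
      finally show ?thesis .
    qed
    have "besov_norm \<phi> \<gamma> p f = (\<Sum>\<^sub>\<infinity>j\<in>?J. ennreal (2 powr (of_int j * \<gamma>)) * Lp_norm p (LP_proj \<phi> j ?f))"
      unfolding besov_norm_def by (rule infsum_cong_neutral) (auto simp: vanish Lp_norm_zero)
    also have "\<dots> = (\<Sum>j\<in>?J. ennreal (2 powr (of_int j * \<gamma>)) * Lp_norm p (LP_proj \<phi> j ?f))" by simp
    also have "\<dots> \<le> (\<Sum>j\<in>?J. ennreal (2 powr (real m * \<bar>\<gamma>\<bar>) * D * t * 2 powr (of_int N * \<gamma>)))"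
      by (rule sum_mono[OF block])
    also have "\<dots> = ennreal (C * t * 2 powr (of_int N * \<gamma>))"
      using D(1) t by (subst sum_ennreal) (auto simp: C_def)
    finally show "besov_norm \<phi> \<gamma> p f \<le> ennreal (C * t * 2 powr (of_int N * \<gamma>))" .
  qed
qed

section \<open>Wave packets\<close>

text \<open>The phase is a parameter because it is shifted twice: by a quarter turn when a packet is differentiated, and
by the choice that keeps the mass of its square.\<close>

definition wave_packet :: "'n::finite \<Rightarrow> (real^'n \<Rightarrow> complex) \<Rightarrow> real \<Rightarrow> real \<Rightarrow> real^'n \<Rightarrow> real" where
  "wave_packet k h \<nu> \<theta> x = Re (inv_fourier h x * cis (\<nu> * x $ k - \<theta>))"

text \<open>Modulation translates the symbol; hence wave packets are Schwartz functions with known spectrum.\<close>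

lemma wave_packet_eq_inv_fourier:
  "wave_packet k h \<nu> \<theta> x = Re (inv_fourier (\<lambda>\<xi>. cis (- \<theta>) * h (\<xi> - \<nu> *\<^sub>R axis k 1)) x)"
  unfolding wave_packet_def inv_fourier_cmult inv_fourier_translate
  by (simp add: inner_axis cis_mult[symmetric] mult_ac flip: cis_mult[of "\<nu> * x $ k" "- \<theta>", simplified])

lemma test_function_modulated:
  "test_function h \<Longrightarrow> test_function (\<lambda>\<xi>. cis (- \<theta>) * h (\<xi> - \<nu> *\<^sub>R axis k 1))"
  by (intro test_function_cmult test_function_translate)

lemma schwartz_wave_packet:
  assumes "test_function h"
  shows "schwartz (wave_packet k h \<nu> \<theta>)"
proof -
  have "wave_packet k h \<nu> \<theta> = (\<lambda>x. Re (inv_fourier (\<lambda>\<xi>. cis (- \<theta>) * h (\<xi> - \<nu> *\<^sub>R axis k 1)) x))"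
    by (rule ext) (rule wave_packet_eq_inv_fourier)
  then show ?thesis
    using schwartz_bounded_linear[OF bounded_linear_Re schwartz_inv_fourier[OF test_function_modulated[OF assms]]]
    by simp
qed

lemma abs_wave_packet_le: "\<bar>wave_packet k h \<nu> \<theta> x\<bar> \<le> norm (inv_fourier h x)"
  using abs_Re_le_cmod[of "inv_fourier h x * cis (\<nu> * x $ k - \<theta>)"] by (simp add: wave_packet_def norm_mult)

lemma schwartz_measurable:
  fixes f :: "real^'n::finite \<Rightarrow> 'b::{second_countable_topology,real_normed_vector}"
  shows "schwartz f \<Longrightarrow> f \<in> borel_measurable borel"
  unfolding schwartz_def by (blast intro: borel_measurable_continuous_onI smooth_continuous)

text \<open>Taking the real part adds the reflected spectrum.\<close>

lemma fourier_Re: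
  assumes f: "integrable lborel f"
  shows "fourier (\<lambda>x. complex_of_real (Re (f x))) \<xi> = (fourier f \<xi> + cnj (fourier f (- \<xi>))) / 2"
proof -
  have "cnj (fourier f (- \<xi>)) = (\<integral>x. cis (- (x \<bullet> \<xi>)) * cnj (f x) \<partial>lborel)"
  proof -
    have "cnj (fourier f (- \<xi>)) = (\<integral>x. cnj (cis (- (x \<bullet> - \<xi>)) * f x) \<partial>lborel)"
      unfolding fourier_def by (rule Bochner_Integration.integral_cnj[symmetric])
    then show ?thesis by (simp add: cis_cnj del: Bochner_Integration.integral_cnj)
  qed
  moreover have "integrable lborel (\<lambda>x. cis (- (x \<bullet> \<xi>)) * f x)" "integrable lborel (\<lambda>x. cis (- (x \<bullet> \<xi>)) * cnj (f x))"
    using f by (auto intro!: integrable_cis_mult)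
  ultimately have "fourier f \<xi> + cnj (fourier f (- \<xi>)) = (\<integral>x. cis (- (x \<bullet> \<xi>)) * f x + cis (- (x \<bullet> \<xi>)) * cnj (f x) \<partial>lborel)"
    by (simp add: fourier_def)
  also have "\<dots> = (\<integral>x. 2 * (cis (- (x \<bullet> \<xi>)) * complex_of_real (Re (f x))) \<partial>lborel)"
    by (rule Bochner_Integration.integral_cong) (simp_all add: complex_add_cnj flip: distrib_left)
  finally show ?thesis by (simp add: fourier_def)
qed

text \<open>The spectrum of a wave packet consists of two copies of the support of \<open>h\<close>, moved to \<open>\<nu>\<close> and \<open>-\<nu>\<close> on the \<open>k\<close>-axis.\<close>

lemma fourier_wave_packet_support:
  assumes h: "test_function h" "\<And>\<xi>. norm \<xi> > R \<Longrightarrow> h \<xi> = 0" and \<nu>: "\<nu> > 0"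
    and nz: "fourier (\<lambda>x. complex_of_real (wave_packet k h \<nu> \<theta> x)) \<xi> \<noteq> 0"
  shows "\<nu> - R \<le> norm \<xi> \<and> norm \<xi> \<le> \<nu> + R"
proof -
  let ?h = "\<lambda>\<xi>. cis (- \<theta>) * h (\<xi> - \<nu> *\<^sub>R axis k 1)"
  have th: "test_function ?h" by (rule test_function_modulated[OF h(1)])
  have "?h \<xi> \<noteq> 0 \<or> ?h (- \<xi>) \<noteq> 0"
  proof (rule ccontr)
    assume "\<not> ?thesis"
    then have "?h \<xi> = 0" "?h (- \<xi>) = 0" by blast+
    then have "fourier (inv_fourier ?h) \<xi> = 0" "fourier (inv_fourier ?h) (- \<xi>) = 0"
      by (simp_all only: fourier_inv_fourier[OF th])
    then show False
      using nz unfolding wave_packet_eq_inv_fourier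
      by (simp add: fourier_Re[OF schwartz_integrable[OF schwartz_inv_fourier[OF th]]])
  qed
  then have "norm (\<xi> - \<nu> *\<^sub>R axis k 1) \<le> R \<or> norm (- \<xi> - \<nu> *\<^sub>R axis k 1) \<le> R"
    using h(2) by (metis mult_zero_right not_le)
  moreover have "norm (\<nu> *\<^sub>R axis k 1 :: real^'a) = \<nu>" using \<nu> by (simp add: norm_axis_1)
  ultimately show ?thesis
    using norm_triangle_ineq3[of \<xi> "\<nu> *\<^sub>R axis k 1"] norm_triangle_ineq3[of "- \<xi>" "\<nu> *\<^sub>R axis k 1"] by auto
qed

text \<open>The derivative of the phase gains the factor \<open>\<nu>\<close> and turns the phase by \<open>\<pi> / 2\<close>; the phase on the left is advanced so that
the leading term is the packet with phase \<open>\<theta>\<close>.  The derivative of the envelope is a packet without the gain.\<close>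

lemma partial_deriv_wave_packet:
  assumes h: "test_function h"
  shows "partial_deriv k (wave_packet k h \<nu> (\<theta> + pi / 2)) x =
    \<nu> * wave_packet k h \<nu> \<theta> x + wave_packet k (\<lambda>\<xi>. \<i> * complex_of_real (\<xi> $ k) * h \<xi>) \<nu> (\<theta> + pi / 2) x"
proof -
  let ?a = "\<lambda>x. \<nu> * x $ k - (\<theta> + pi / 2)"
  have "((\<lambda>x. ?a x) has_derivative (\<lambda>v. \<nu> * v $ k)) (at x)"
    using has_derivative_diff[OF has_derivative_mult_right has_derivative_const]
      bounded_linear_imp_has_derivative[OF bounded_linear_vec_nth] by fastforce
  from bounded_linear.has_derivative[OF bounded_linear_Re
      has_derivative_mult[OF has_derivative_inv_fourier[OF h] has_derivative_cis[OF this]]]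
  have "((\<lambda>x. Re (inv_fourier h x * cis (?a x))) has_derivative
    (\<lambda>v. Re (inv_fourier h x * ((\<nu> * v $ k) *\<^sub>R (\<i> * cis (?a x)))
      + inv_fourier (\<lambda>\<xi>. \<i> * complex_of_real (v \<bullet> \<xi>) * h \<xi>) x * cis (?a x)))) (at x)" .
  from partial_deriv_eqI[OF this, of k]
  have "partial_deriv k (wave_packet k h \<nu> (\<theta> + pi / 2)) x =
     Re (inv_fourier h x * (\<nu> *\<^sub>R (\<i> * cis (?a x))) + inv_fourier (\<lambda>\<xi>. \<i> * complex_of_real (\<xi> $ k) * h \<xi>) x * cis (?a x))"
    by (simp add: wave_packet_def[abs_def] inner_axis')
  moreover have "\<i> * cis (?a x) = cis (\<nu> * x $ k - \<theta>)"
    using cis_mult[of "pi / 2" "?a x"] by (simp add: cis_pi_half)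
  ultimately show ?thesis by (simp add: wave_packet_def scaleR_conv_of_real algebra_simps)
qed

text \<open>A Schwartz function that is constant along the lines in one direction vanishes, because it
decays along them.\<close>

lemma schwartz_partial_deriv_zero:
  fixes u :: "real^'n::finite \<Rightarrow> real"
  assumes u: "schwartz u" and zero: "\<And>x. partial_deriv k u x = 0"
  shows "u x = 0"
proof -
  let ?e = "axis k 1 :: real^'n"
  have "((\<lambda>s. u (x + s *\<^sub>R ?e)) has_real_derivative 0) (at s)" for s
  proof -
    have du: "u differentiable (at y)" for y using u smooth_differentiable unfolding schwartz_def by blast
    have "((\<lambda>s. x + s *\<^sub>R ?e) has_derivative (\<lambda>r. r *\<^sub>R ?e)) (at s)"
      by (auto intro!: derivative_eq_intros)
    from diff_chain_at[OF this has_derivative_frechet[OF du]]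
    have "((\<lambda>s. u (x + s *\<^sub>R ?e)) has_derivative (\<lambda>r. frechet_derivative u (at (x + s *\<^sub>R ?e)) (r *\<^sub>R ?e))) (at s)"
      by (simp add: o_def)
    moreover have "frechet_derivative u (at y) (r *\<^sub>R ?e) = 0 * r" for y r
      using linear_cmul[OF linear_frechet_derivative[OF du[of y]], of r ?e] zero[of y] by (simp add: partial_deriv_def)
    ultimately show ?thesis by (simp add: has_field_derivative_def lambda_zero)
  qed
  then have const: "u (x + s *\<^sub>R ?e) = u x" for s
    using DERIV_isconst_all[of "\<lambda>s. u (x + s *\<^sub>R ?e)" s 0] by simp
  obtain C where C: "\<And>y. norm y * \<bar>u y\<bar> \<le> C"
    using schwartz_bounded[OF u, of 1] by (auto simp: bounded_iff abs_mult)
  show "u x = 0"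
  proof (rule ccontr)
    assume "u x \<noteq> 0"
    \<comment> \<open>So far out on the line that the decay bound contradicts the constant value \<open>u x\<close>.\<close>
    define s where "s = norm x + (\<bar>C\<bar> + 1) / \<bar>u x\<bar>"
    have "s \<ge> 0" by (simp add: s_def)
    then have "s - norm x \<le> norm (x + s *\<^sub>R ?e)"
      using norm_triangle_ineq2[of "s *\<^sub>R ?e" "- x"] by (simp add: norm_axis_1 add.commute)
    then have "(s - norm x) * \<bar>u x\<bar> \<le> C"
      using C[of "x + s *\<^sub>R ?e"] by (simp add: const) (meson abs_ge_zero mult_right_mono order_trans)
    then show False using \<open>u x \<noteq> 0\<close> by (simp add: s_def)
  qed
qed

section \<open>Unidirectional vector fields\<close>

lemma advect_unidirectional:
  assumes "\<And>x. F differentiable (at x)"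
  shows "advect (\<lambda>x. g x *\<^sub>R axis k 1) (\<lambda>x. F x *\<^sub>R axis k 1) x $ k = g x * partial_deriv k F x"
proof -
  have "partial_deriv l (\<lambda>x. F x *\<^sub>R (axis k 1 :: real^'a)) x = partial_deriv l F x *\<^sub>R axis k 1" for l
    by (rule partial_deriv_bounded_linear[OF bounded_linear_scaleR_left assms])
  then have "((g x *\<^sub>R axis k 1 :: real^'a) $ l *\<^sub>R partial_deriv l (\<lambda>x. F x *\<^sub>R (axis k 1 :: real^'a)) x) $ k
      = (if l = k then g x * partial_deriv k F x else 0)" for l
    by (simp add: axis_def)
  then show ?thesis by (simp add: advect_def)
qed

lemma besov_norm_vec_unidirectional:
  fixes f :: "real^'n::finite \<Rightarrow> real"
  shows "besov_norm_vec \<phi> \<gamma> p (\<lambda>x. f x *\<^sub>R axis k 1) = besov_norm \<phi> \<gamma> p f"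
proof -
  have "besov_norm \<phi> \<gamma> p (\<lambda>x. (f x *\<^sub>R (axis k 1 :: real^'n)) $ i) = (if i = k then besov_norm \<phi> \<gamma> p f else 0)" for i
    by (simp add: axis_def besov_norm_zero)
  then show ?thesis by (simp add: besov_norm_vec_def)
qed

lemma besov_norm_le_vec: "besov_norm \<phi> \<gamma> p (\<lambda>x. v x $ k) \<le> besov_norm_vec \<phi> \<gamma> p v"
  unfolding besov_norm_vec_def
  using member_le_sum[of k UNIV "\<lambda>i. besov_norm \<phi> \<gamma> p (\<lambda>x. v x $ i)"] by simp

lemma divergence_unidirectional:
  "divergence (\<lambda>x. g x *\<^sub>R axis k 1) x = partial_deriv k g x"
proof -
  have "partial_deriv l (\<lambda>y. (g y *\<^sub>R (axis k 1 :: real^'a)) $ l) x = (if l = k then partial_deriv k g x else 0)" for l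
    by (simp add: axis_def)
  then show ?thesis by (simp add: divergence_def)
qed

section \<open>The resonant interaction of two wave packets\<close>

lemma integrable_norm_mult_schwartz:
  fixes u v :: "real^'n::finite \<Rightarrow> complex"
  assumes u: "schwartz u" and v: "schwartz v"
  shows "integrable lborel (\<lambda>x. norm (u x) * norm (v x))"
proof -
  obtain M where M: "\<And>x. norm (u x) \<le> M" using schwartz_bounded[OF u, of 0] by (auto simp: bounded_iff)
  have [measurable]: "u \<in> borel_measurable borel" "v \<in> borel_measurable borel"
    using u v by (auto intro: schwartz_measurable)
  show ?thesis
  proof (rule Bochner_Integration.integrable_bound)
    show "integrable lborel (\<lambda>x. M * norm (v x))" using schwartz_integrable[OF v] by simp
    have "norm (u x) * norm (v x) \<le> \<bar>M * norm (v x)\<bar>" for x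
      using mult_right_mono[OF M norm_ge_zero, of x "v x"] by linarith
    then show "AE x in lborel. norm (norm (u x) * norm (v x)) \<le> norm (M * norm (v x))" by simp
  qed measurable
qed

lemma integrable_wave_packet_product:
  assumes h: "test_function h" and g: "test_function g"
  shows "integrable lborel (\<lambda>x. wave_packet k h \<nu> \<theta> x * wave_packet k g \<mu> \<eta> x)"
proof (rule Bochner_Integration.integrable_bound)
  show "integrable lborel (\<lambda>x. norm (inv_fourier h x) * norm (inv_fourier g x))"
    by (intro integrable_norm_mult_schwartz schwartz_inv_fourier h g)
  have [measurable]: "wave_packet k h \<nu> \<theta> \<in> borel_measurable borel" "wave_packet k g \<mu> \<eta> \<in> borel_measurable borel"
    using h g by (auto intro: schwartz_measurable schwartz_wave_packet)
  show "(\<lambda>x. wave_packet k h \<nu> \<theta> x * wave_packet k g \<mu> \<eta> x) \<in> borel_measurable lborel" by measurable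
  show "AE x in lborel. norm (wave_packet k h \<nu> \<theta> x * wave_packet k g \<mu> \<eta> x) \<le> norm (norm (inv_fourier h x) * norm (inv_fourier g x))"
    by (auto simp: abs_mult intro!: mult_mono abs_wave_packet_le)
qed

text \<open>The squares of the packets with phases \<open>0\<close> and \<open>\<pi> / 2\<close> add up to the squared envelope, so one of the two
carries at least half of its mass.  This choice replaces an appeal to the Riemann-Lebesgue lemma.\<close>

lemma wave_packet_phase:
  assumes h: "test_function h"
  obtains \<theta> where "(\<integral>x. (norm (inv_fourier h x))\<^sup>2 \<partial>lborel) / 2 \<le> (\<integral>x. (wave_packet k h \<nu> \<theta> x)\<^sup>2 \<partial>lborel)"
proof -
  have "(norm (inv_fourier h x))\<^sup>2 = (wave_packet k h \<nu> 0 x)\<^sup>2 + (wave_packet k h \<nu> (pi / 2) x)\<^sup>2" for x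
  proof -
    have "cis (\<nu> * x $ k - pi / 2) = - \<i> * cis (\<nu> * x $ k)"
      using cis_mult[of "\<nu> * x $ k" "- (pi / 2)"] by (simp add: cis_minus_pi_half mult.commute)
    then have "wave_packet k h \<nu> (pi / 2) x = Im (inv_fourier h x * cis (\<nu> * x $ k))"
      by (simp add: wave_packet_def algebra_simps)
    then show ?thesis
      using cmod_power2[of "inv_fourier h x * cis (\<nu> * x $ k)"] by (simp add: wave_packet_def norm_mult)
  qed
  then have "(\<integral>x. (norm (inv_fourier h x))\<^sup>2 \<partial>lborel)
      = (\<integral>x. (wave_packet k h \<nu> 0 x)\<^sup>2 \<partial>lborel) + (\<integral>x. (wave_packet k h \<nu> (pi / 2) x)\<^sup>2 \<partial>lborel)"
    using integrable_wave_packet_product[OF h h] by (simp add: power2_eq_square)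
  then have "(\<integral>x. (norm (inv_fourier h x))\<^sup>2 \<partial>lborel) / 2 \<le> (\<integral>x. (wave_packet k h \<nu> 0 x)\<^sup>2 \<partial>lborel) \<or>
      (\<integral>x. (norm (inv_fourier h x))\<^sup>2 \<partial>lborel) / 2 \<le> (\<integral>x. (wave_packet k h \<nu> (pi / 2) x)\<^sup>2 \<partial>lborel)"
    by linarith
  then show ?thesis using that by blast
qed

lemma schwartz_cmult:
  fixes f :: "real^'n::finite \<Rightarrow> real"
  shows "schwartz f \<Longrightarrow> schwartz (\<lambda>x. c * f x)"
  by (rule schwartz_bounded_linear[OF bounded_linear_mult_right])

text \<open>Normalised by \<open>\<nu> powr (- \<gamma>)\<close>, the wave packets of frequency \<open>\<nu> = 2^N\<close> are bounded in the space of any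
regularity \<open>\<gamma>\<close>, uniformly in their phase.\<close>

lemma besov_norm_wave_packet_le:
  fixes \<phi> :: "real^'n::finite \<Rightarrow> real"
  assumes \<phi>: "LP_cutoff \<phi>" and p: "p > 1" and h: "test_function h" "\<And>\<xi>. norm \<xi> > R \<Longrightarrow> h \<xi> = 0"
  obtains C where "C \<ge> 0" "\<And>N \<theta>. 2 * R \<le> 2 ^ N \<Longrightarrow>
    besov_norm \<phi> \<gamma> p (\<lambda>x. (2 ^ N) powr (- \<gamma>) * wave_packet k h (2 ^ N) \<theta> x) \<le> ennreal C"
proof -
  let ?W = "\<lambda>x. norm (inv_fourier h x)"
  obtain M where M: "\<And>x. ?W x \<le> M"
    using schwartz_bounded[OF schwartz_inv_fourier[OF h(1)], of 0] by (auto simp: bounded_iff)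
  have W: "integrable lborel ?W" using schwartz_integrable[OF schwartz_inv_fourier[OF h(1)]] by simp
  obtain C where C: "C \<ge> 0" "\<And>N t f. t > 0 \<Longrightarrow> f \<in> borel_measurable borel \<Longrightarrow> (\<And>x. \<bar>f x\<bar> \<le> t * ?W x) \<Longrightarrow>
    (\<And>\<xi>. fourier (\<lambda>x. complex_of_real (f x)) \<xi> \<noteq> 0 \<Longrightarrow>
      2 powr (real_of_int N - 1) \<le> norm \<xi> \<and> norm \<xi> \<le> 2 powr (real_of_int N + 1)) \<Longrightarrow>
    besov_norm \<phi> \<gamma> p f \<le> ennreal (C * t * 2 powr (of_int N * \<gamma>))"
    using besov_norm_localized_le[OF \<phi> p W M] by metis
  show ?thesis
  proof (rule that[OF C(1)])
    fix N :: nat and \<theta> assume N: "2 * R \<le> 2 ^ N"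
    let ?t = "(2 ^ N) powr (- \<gamma>) :: real"
    let ?w = "wave_packet k h (2 ^ N) \<theta>"
    have "besov_norm \<phi> \<gamma> p (\<lambda>x. ?t * ?w x) \<le> ennreal (C * ?t * 2 powr (of_int (int N) * \<gamma>))"
    proof (rule C(2))
      show "(\<lambda>x. ?t * ?w x) \<in> borel_measurable borel"
        by (intro schwartz_measurable schwartz_cmult schwartz_wave_packet h)
      show "\<bar>?t * ?w x\<bar> \<le> ?t * ?W x" for x by (simp add: abs_mult mult_left_mono abs_wave_packet_le)
      fix \<xi> assume "fourier (\<lambda>x. complex_of_real (?t * ?w x)) \<xi> \<noteq> 0"
      moreover have "fourier (\<lambda>x. complex_of_real (?t * ?w x)) \<xi> = ?t * fourier (\<lambda>x. complex_of_real (?w x)) \<xi>"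
        by (simp add: fourier_def mult.left_commute flip: integral_mult_right_zero)
      ultimately have "fourier (\<lambda>x. complex_of_real (?w x)) \<xi> \<noteq> 0" by auto
      then have "2 ^ N - R \<le> norm \<xi> \<and> norm \<xi> \<le> 2 ^ N + R"
        by (rule fourier_wave_packet_support[OF h, rotated -1]) simp_all
      then show "2 powr (real_of_int (int N) - 1) \<le> norm \<xi> \<and> norm \<xi> \<le> 2 powr (real_of_int (int N) + 1)"
        using N by (simp add: powr_diff powr_add powr_realpow)
    qed simp
    also have "C * ?t * 2 powr (of_int (int N) * \<gamma>) = C"
    proof -
      have "(2 ^ N :: real) = 2 powr real N" by (simp add: powr_realpow)
      then have "?t * 2 powr (of_int (int N) * \<gamma>) = 1" by (simp add: powr_powr flip: powr_add)
      then show ?thesis by (simp add: mult.assoc)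
    qed
    finally show "besov_norm \<phi> \<gamma> p (\<lambda>x. ?t * ?w x) \<le> ennreal C" .
  qed
qed

theorem proposition3p3:
  fixes \<phi> :: "real^'n::finite \<Rightarrow> real" and p s :: real
  assumes "CARD('n) \<ge> 2"
    and "LP_cutoff \<phi>"
    and "1 < p"
    and "0 < s" and "s < 1/2"
  shows
    "(\<exists>f g :: nat \<Rightarrow> real^'n \<Rightarrow> real.
        (\<forall>N. schwartz (f N) \<and> schwartz (g N)) \<and>
        (SUP N. besov_norm \<phi> s p (f N)) + (SUP N. besov_norm \<phi> (s - 1) p (g N)) < \<infinity> \<and>
        (\<lambda>N. besov_norm \<phi> (s - 1) p (\<lambda>x. f N x * g N x)) \<longlonglongrightarrow> \<infinity>) \<and>
     (\<exists>a Y :: nat \<Rightarrow> real^'n \<Rightarrow> real^'n.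
        (\<forall>N. schwartz (a N) \<and> schwartz (Y N) \<and> \<not> divergence_free (a N)) \<and>
        (SUP N. besov_norm_vec \<phi> (s - 1) p (a N)) + (SUP N. besov_norm_vec \<phi> (s + 1) p (Y N)) < \<infinity> \<and>
        (\<lambda>N. besov_norm_vec \<phi> (s - 1) p (advect (a N) (Y N))) \<longlonglongrightarrow> \<infinity>)"
proof -
  note \<phi> = assms(2) and p = assms(3)
  fix k :: 'n
  let ?h = "\<lambda>\<xi>. complex_of_real (\<phi> \<xi>)" and ?h' = "\<lambda>\<xi>. \<i> * complex_of_real (\<xi> $ k) * complex_of_real (\<phi> \<xi>)"
  have h: "test_function ?h" by (rule LP_cutoff_test_function[OF \<phi>])
  have h': "test_function ?h'" using test_function_inner_mult[OF h, of "axis k 1"] by (simp add: inner_axis')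
  obtain R where R: "\<And>\<xi>. norm \<xi> > R \<Longrightarrow> ?h \<xi> = 0" using h unfolding test_function_def by blast
  let ?\<Psi> = "inv_fourier ?h" and ?\<Psi>' = "inv_fourier ?h'"
  let ?W = "\<lambda>x. (norm (?\<Psi> x))\<^sup>2"
  have W: "integrable lborel ?W"
    using integrable_norm_mult_schwartz[OF schwartz_inv_fourier[OF h] schwartz_inv_fourier[OF h]]
    by (simp add: power2_eq_square)
  define m where "m = (\<integral>x. ?W x \<partial>lborel) / 2"
  have m: "m > 0"
  proof -
    have "continuous_on UNIV ?\<Psi>"
      using schwartz_inv_fourier[OF h] smooth_continuous unfolding schwartz_def by blast
    moreover have "?W 0 > 0" using LP_kernel_0_pos[OF \<phi>] by (auto simp: LP_kernel_def)
    ultimately show ?thesis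
      unfolding m_def using integral_continuous_pos[of ?W 0] W by (simp add: continuous_intros)
  qed
  have p0: "p > 0" using p by simp
  obtain j c \<epsilon> where c: "c > 0" "\<epsilon> > 0"
    "\<forall>u w t. integrable lborel u \<and> integrable lborel w \<and> (\<forall>x. 0 \<le> w x \<and> w x \<le> ?W x) \<and>
      m \<le> (\<integral>x. w x \<partial>lborel) \<and> (\<integral>x. \<bar>u x - w x\<bar> \<partial>lborel) \<le> \<epsilon> \<and> t > 0 \<longrightarrow>
      ennreal (t * c) \<le> Lp_norm p (LP_proj \<phi> j (\<lambda>x. complex_of_real (t * u x)))"
    by (rule Lp_norm_LP_proj_ge[OF \<phi> p0 W m]) (erule (2) that)
  define E where "E = (\<integral>x. norm (?\<Psi> x) * norm (?\<Psi>' x) \<partial>lborel)"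
  \<comment> \<open>From \<open>2^N0\<close> on, the spectra keep away from \<open>0\<close> and the error term below stays under \<open>\<epsilon>\<close>.\<close>
  obtain N0 where N0: "max (2 * R) (E / \<epsilon>) < 2 ^ N0"
    using real_arch_pow[of 2 "max (2 * R) (E / \<epsilon>)"] by auto
  define \<nu> where "\<nu> N = (2 :: real) ^ (N0 + N)" for N
  have \<nu>: "\<nu> N > 0" "2 * R \<le> 2 ^ (N0 + N)" "E / \<epsilon> \<le> \<nu> N" for N
  proof -
    have "(2::real) ^ N0 \<le> 2 ^ (N0 + N)" by (simp add: power_increasing)
    then show "2 * R \<le> 2 ^ (N0 + N)" "E / \<epsilon> \<le> \<nu> N"
      using N0 unfolding \<nu>_def max_less_iff_conj by linarith+
    show "\<nu> N > 0" by (simp add: \<nu>_def)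
  qed
  have "\<exists>\<theta>. m \<le> (\<integral>x. (wave_packet k ?h (\<nu> N) \<theta> x)\<^sup>2 \<partial>lborel)" for N
    using wave_packet_phase[OF h, of k "\<nu> N"] unfolding m_def by metis
  then obtain \<theta> where \<theta>: "\<And>N. m \<le> (\<integral>x. (wave_packet k ?h (\<nu> N) (\<theta> N) x)\<^sup>2 \<partial>lborel)" by metis
  let ?w = "\<lambda>N. wave_packet k ?h (\<nu> N) (\<theta> N)"
  let ?e = "\<lambda>N. wave_packet k ?h' (\<nu> N) (\<theta> N + pi / 2)"
  define f where "f N x = \<nu> N powr (- s) * ?w N x" for N x
  define g where "g N x = \<nu> N powr (- (s - 1)) * ?w N x" for N x
  \<comment> \<open>The profile of \<open>Y\<close>: its derivative in direction \<open>k\<close> reproduces \<open>f N\<close> up to a relative error \<open>1 / \<nu> N\<close>.\<close>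
  define F where "F N x = \<nu> N powr (- (s + 1)) * wave_packet k ?h (\<nu> N) (\<theta> N + pi / 2) x" for N x
  have schwartz: "schwartz (f N)" "schwartz (g N)" "schwartz (F N)" for N
    unfolding f_def[abs_def] g_def[abs_def] F_def[abs_def] by (intro schwartz_cmult schwartz_wave_packet h)+
  have bounded: "\<exists>C\<ge>0. \<forall>N \<eta>. besov_norm \<phi> \<gamma> p (\<lambda>x. \<nu> N powr (- \<gamma>) * wave_packet k ?h (\<nu> N) \<eta> x) \<le> ennreal C" for \<gamma>
    using besov_norm_wave_packet_le[OF \<phi> p h R, where \<gamma> = \<gamma> and k = k] \<nu>(2) unfolding \<nu>_def by metis
  obtain Cf Cg CF where C: "\<And>N. besov_norm \<phi> s p (f N) \<le> ennreal Cf"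
      "\<And>N. besov_norm \<phi> (s - 1) p (g N) \<le> ennreal Cg" "\<And>N. besov_norm \<phi> (s + 1) p (F N) \<le> ennreal CF"
    using bounded[of s] bounded[of "s - 1"] bounded[of "s + 1"]
    unfolding f_def[abs_def] g_def[abs_def] F_def[abs_def] by metis
  have finite: "(SUP N. b N) + (SUP N. b' N) < \<infinity>"
    if "\<And>N::nat. b N \<le> ennreal C" "\<And>N::nat. b' N \<le> ennreal C'" for b b' C C'
  proof -
    have "(SUP N. b N) + (SUP N. b' N) \<le> ennreal C + ennreal C'" by (intro add_mono SUP_least that)
    also have "\<dots> < \<infinity>" by simp
    finally show ?thesis .
  qed
  have dF: "partial_deriv k (F N) x = \<nu> N powr (- s) * (?w N x + ?e N x / \<nu> N)" for N x
  proof -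
    have "schwartz (wave_packet k ?h (\<nu> N) (\<theta> N + pi / 2))" by (rule schwartz_wave_packet[OF h])
    then have "partial_deriv k (F N) x = \<nu> N powr (- (s + 1)) * partial_deriv k (wave_packet k ?h (\<nu> N) (\<theta> N + pi / 2)) x"
      unfolding F_def[abs_def] schwartz_def
      by (intro partial_deriv_bounded_linear[OF bounded_linear_mult_right] smooth_differentiable) simp
    also have "\<dots> = \<nu> N powr (- (s + 1)) * (\<nu> N * ?w N x + ?e N x)"
      by (simp only: partial_deriv_wave_packet[OF h])
    also have "\<nu> N powr (- (s + 1)) = \<nu> N powr (- s) / \<nu> N"
      using \<nu>(1)[of N] powr_diff[of "\<nu> N" "- s" 1] by simp
    finally show ?thesis using \<nu>(1)[of N] by (simp add: field_simps)
  qed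
  let ?t = "\<lambda>N. \<nu> N powr (1 - 2 * s)"
  \<comment> \<open>The gain of the resonance: the exponents \<open>- s\<close> and \<open>1 - s\<close> leave the positive power \<open>1 - 2 s\<close>.\<close>
  have tt: "\<nu> N powr (- s) * \<nu> N powr (- (s - 1)) = ?t N" for N by (simp flip: powr_add)
  \<comment> \<open>Both parts follow once the product is \<open>?t N\<close> times an \<open>L^1\<close> perturbation of the square of the packet.\<close>
  have blowup: "(\<lambda>N. b N) \<longlonglongrightarrow> \<infinity>" if b: "\<And>N. besov_norm \<phi> (s - 1) p (\<lambda>x. ?t N * u N x) \<le> b N"
    and u: "\<And>N. integrable lborel (u N)" "\<And>N. (\<integral>x. \<bar>u N x - (?w N x)\<^sup>2\<bar> \<partial>lborel) \<le> \<epsilon>" for b and u :: "nat \<Rightarrow> real^'n \<Rightarrow> real"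
  proof -
    let ?c = "2 powr (of_int j * (s - 1)) * c"
    have "ennreal (?t N * ?c) \<le> b N" for N
    proof -
      have "ennreal (?t N * c) \<le> Lp_norm p (LP_proj \<phi> j (\<lambda>x. complex_of_real (?t N * u N x)))"
      proof (rule c(3)[rule_format], intro conjI allI)
        show "integrable lborel (\<lambda>x. (?w N x)\<^sup>2)"
          using integrable_wave_packet_product[OF h h] by (simp add: power2_eq_square)
        show "0 \<le> (?w N x)\<^sup>2" "(?w N x)\<^sup>2 \<le> ?W x" for x
          using power_mono[OF abs_wave_packet_le, of k ?h "\<nu> N" "\<theta> N" x 2] by simp_all
        show "0 < ?t N" using \<nu>(1)[of N] by simp
      qed (use u \<theta> in auto)
      then have "ennreal (2 powr (of_int j * (s - 1))) * ennreal (?t N * c)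
        \<le> ennreal (2 powr (of_int j * (s - 1))) * Lp_norm p (LP_proj \<phi> j (\<lambda>x. complex_of_real (?t N * u N x)))"
        by (rule mult_left_mono) simp
      also have "\<dots> \<le> besov_norm \<phi> (s - 1) p (\<lambda>x. ?t N * u N x)" by (rule besov_norm_ge_block)
      also have "\<dots> \<le> b N" by (rule b)
      finally show ?thesis by (simp add: ennreal_mult'[symmetric] mult_ac)
    qed
    moreover have "(\<lambda>N. ennreal (?t N * ?c)) \<longlonglongrightarrow> \<infinity>"
    proof -
      have "?t N = exp ((1 - 2 * s) * ln 2 * real N0 + (1 - 2 * s) * ln 2 * real N)" for N
        using \<nu>(1)[of N] by (simp add: powr_def \<nu>_def ln_realpow algebra_simps)
      moreover have "filterlim (\<lambda>N. (1 - 2 * s) * ln 2 * real N0 + (1 - 2 * s) * ln 2 * real N) at_top sequentially"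
        using assms(5) by (intro filterlim_tendsto_add_at_top[OF tendsto_const]
            filterlim_tendsto_pos_mult_at_top[OF tendsto_const _ filterlim_real_sequentially]) auto
      ultimately have "filterlim ?t at_top sequentially"
        by (simp add: filterlim_compose[OF exp_at_top])
      then have "filterlim (\<lambda>N. ?t N * ?c) at_top sequentially"
        using c(1) by (intro filterlim_at_top_mult_tendsto_pos[OF tendsto_const]) auto
      then show ?thesis by (simp only: ennreal_tendsto_top_eq_at_top infinity_ennreal_def)
    qed
    ultimately show ?thesis
      by (intro tendsto_sandwich[where f = "\<lambda>N. ennreal (?t N * ?c)" and g = b and h = "\<lambda>N. \<infinity>", OF _ _ _ tendsto_const])
         simp_all
  qed
  have part1: "(\<lambda>N. besov_norm \<phi> (s - 1) p (\<lambda>x. f N x * g N x)) \<longlonglongrightarrow> \<infinity>"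
  proof (rule blowup[where u = "\<lambda>N x. (?w N x)\<^sup>2"])
    have "?t N * (?w N x)\<^sup>2 = f N x * g N x" for N x
      by (simp add: f_def g_def power2_eq_square tt[symmetric])
    then show "besov_norm \<phi> (s - 1) p (\<lambda>x. ?t N * (?w N x)\<^sup>2) \<le> besov_norm \<phi> (s - 1) p (\<lambda>x. f N x * g N x)" for N
      by simp
    show "integrable lborel (\<lambda>x. (?w N x)\<^sup>2)" for N
      using integrable_wave_packet_product[OF h h] by (simp add: power2_eq_square)
  qed (use c in simp)
  define a where "a N x = g N x *\<^sub>R (axis k 1 :: real^'n)" for N x
  define Y where "Y N x = F N x *\<^sub>R (axis k 1 :: real^'n)" for N x
  have part2: "(\<lambda>N. besov_norm_vec \<phi> (s - 1) p (advect (a N) (Y N))) \<longlonglongrightarrow> \<infinity>"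
  proof (rule blowup[where u = "\<lambda>N x. (?w N x)\<^sup>2 + ?w N x * ?e N x / \<nu> N"])
    fix N
    have "F N differentiable (at x)" for x using schwartz(3) smooth_differentiable unfolding schwartz_def by blast
    then have "advect (a N) (Y N) x $ k = g N x * (\<nu> N powr (- s) * (?w N x + ?e N x / \<nu> N))" for x
      unfolding a_def[abs_def] Y_def[abs_def] by (simp only: advect_unidirectional dF)
    also have "g N x * (\<nu> N powr (- s) * (?w N x + ?e N x / \<nu> N))
      = (\<nu> N powr (- s) * \<nu> N powr (- (s - 1))) * ((?w N x)\<^sup>2 + ?w N x * ?e N x / \<nu> N)" for x
      by (simp add: g_def power2_eq_square algebra_simps)
    finally have "advect (a N) (Y N) x $ k = ?t N * ((?w N x)\<^sup>2 + ?w N x * ?e N x / \<nu> N)" for x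
      unfolding tt .
    then show "besov_norm \<phi> (s - 1) p (\<lambda>x. ?t N * ((?w N x)\<^sup>2 + ?w N x * ?e N x / \<nu> N))
      \<le> besov_norm_vec \<phi> (s - 1) p (advect (a N) (Y N))"
      using besov_norm_le_vec[of \<phi> "s - 1" p "advect (a N) (Y N)" k] by simp
    note int = integrable_wave_packet_product[OF h h, of k "\<nu> N" "\<theta> N" "\<nu> N" "\<theta> N"]
      integrable_wave_packet_product[OF h h', of k "\<nu> N" "\<theta> N" "\<nu> N" "\<theta> N + pi / 2"]
    show "integrable lborel (\<lambda>x. (?w N x)\<^sup>2 + ?w N x * ?e N x / \<nu> N)"
      using int by (simp add: power2_eq_square)
    have "(\<integral>x. \<bar>(?w N x)\<^sup>2 + ?w N x * ?e N x / \<nu> N - (?w N x)\<^sup>2\<bar> \<partial>lborel) \<le> (\<integral>x. norm (?\<Psi> x) * norm (?\<Psi>' x) / \<nu> N \<partial>lborel)"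
    proof (rule integral_mono_AE')
      show "integrable lborel (\<lambda>x. norm (?\<Psi> x) * norm (?\<Psi>' x) / \<nu> N)"
        using integrable_norm_mult_schwartz[OF schwartz_inv_fourier[OF h] schwartz_inv_fourier[OF h']] by simp
      show "AE x in lborel. \<bar>(?w N x)\<^sup>2 + ?w N x * ?e N x / \<nu> N - (?w N x)\<^sup>2\<bar> \<le> norm (?\<Psi> x) * norm (?\<Psi>' x) / \<nu> N"
        using \<nu>(1)[of N] by (auto simp: abs_mult intro!: divide_right_mono mult_mono abs_wave_packet_le)
    qed (use \<nu>(1)[of N] in simp)
    also have "\<dots> = E / \<nu> N" by (simp add: E_def)
    also have "\<dots> \<le> \<epsilon>" using \<nu>(1,3)[of N] c(2) by (simp add: field_simps)
    finally show "(\<integral>x. \<bar>(?w N x)\<^sup>2 + ?w N x * ?e N x / \<nu> N - (?w N x)\<^sup>2\<bar> \<partial>lborel) \<le> \<epsilon>" .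
  qed
  have not_div_free: "\<not> divergence_free (a N)" for N
  proof
    assume "divergence_free (a N)"
    then have "partial_deriv k (g N) x = 0" for x
      unfolding divergence_free_def a_def[abs_def] divergence_unidirectional by blast
    then have "g N x = 0" for x by (rule schwartz_partial_deriv_zero[OF schwartz(2)])
    then have "?w N x = 0" for x using \<nu>(1)[of N] unfolding g_def by simp
    then show False using \<theta>[of N] m by simp
  qed
  have vec: "schwartz (a N)" "schwartz (Y N)" for N
    unfolding a_def[abs_def] Y_def[abs_def]
    by (intro schwartz_bounded_linear[OF bounded_linear_scaleR_left] schwartz)+
  have "(SUP N. besov_norm_vec \<phi> (s - 1) p (a N)) + (SUP N. besov_norm_vec \<phi> (s + 1) p (Y N)) < \<infinity>"
    unfolding a_def[abs_def] Y_def[abs_def] besov_norm_vec_unidirectional by (rule finite[OF C(2,3)])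
  moreover have "(SUP N. besov_norm \<phi> s p (f N)) + (SUP N. besov_norm \<phi> (s - 1) p (g N)) < \<infinity>"
    by (rule finite[OF C(1,2)])
  ultimately show ?thesis
    using schwartz(1,2) part1 part2 not_div_free vec
    by (intro conjI exI[of _ f] exI[of _ g] exI[of _ a] exI[of _ Y] allI) auto
qed

end
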